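(* Let $T>0$. The problem $$u_{tt}-(x^2u_x)_x=0\ \text{ in }]0,T[\times]0,1[,\qquad u(t,1)=0,\quad\lim_{x\downarrow0}x^2u_x(t,x)=0\ \ (0<t<T),\qquad u(0,\cdot)=u_0,\ u_t(0,\cdot)=u_1,$$ is not observable on $[0,T]$ via the normal derivative $u_x(\cdot,1)$: there exist smooth functions $u_0,u_1$ with compact support in $]0,1[$, not identically zero, such that the corresponding solution satisfies $u_x(t,1)=0$ for all $t\in[0,T]$; consequently there is no constant $C>0$ such that $\int_0^Tu_x^2(t,1)\,dt\geqslant C\,E_u(0)$ for all solutions $u$ with smooth compactly supported data.
   Context: The energy is $E_u(t)=\frac12\int_0^1\{u_t^2(t,x)+x^2u_x^2(t,x)\}dx$. Solutions are understood in the classical sense (the data being smooth with compact support in $]0,1[$). *)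

theory Defs
  imports "HOL-Analysis.Analysis"
begin

text \<open>Smooth functions with compact support in the open unit interval, extended by zero to
  the whole line. The closure of the support is closed in the line and contained in a bounded
  set, hence compact.\<close>

definition smooth :: "(real \<Rightarrow> real) \<Rightarrow> bool" where
  "smooth f \<longleftrightarrow> (\<forall>n x. (deriv ^^ n) f differentiable (at x))"

definition test_function :: "(real \<Rightarrow> real) \<Rightarrow> bool" where
  "test_function f \<longleftrightarrow> smooth f \<and> closure {x. f x \<noteq> 0} \<subseteq> {0<..<1}"

text \<open>A function \<open>u t x\<close> is considered on \<open>[0,T] \<times> ]0,1]\<close> only. Derivatives are taken within this
  set, so they are the usual ones in the interior and one-sided at \<open>t = 0\<close>, \<open>t = T\<close>
  and \<open>x = 1\<close>; in particular \<open>d_x u t 1\<close> is the normal derivative at the boundary point.\<close>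

definition d_t :: "real \<Rightarrow> (real \<Rightarrow> real \<Rightarrow> real) \<Rightarrow> real \<Rightarrow> real \<Rightarrow> real" where
  "d_t T u t x = vector_derivative (\<lambda>s. u s x) (at t within {0..T})"

definition d_x :: "(real \<Rightarrow> real \<Rightarrow> real) \<Rightarrow> real \<Rightarrow> real \<Rightarrow> real" where
  "d_x u t x = vector_derivative (u t) (at x within {0<..1})"

definition C1_on_strip :: "real \<Rightarrow> (real \<Rightarrow> real \<Rightarrow> real) \<Rightarrow> bool" where
  "C1_on_strip T u \<longleftrightarrow>
     (\<forall>t\<in>{0..T}. \<forall>x\<in>{0<..1}.
        (\<lambda>s. u s x) differentiable (at t within {0..T}) \<and>
        u t differentiable (at x within {0<..1})) \<and>
     continuous_on ({0..T} \<times> {0<..1}) (\<lambda>(t, x). d_t T u t x) \<and>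
     continuous_on ({0..T} \<times> {0<..1}) (\<lambda>(t, x). d_x u t x)"

definition C2_on_strip :: "real \<Rightarrow> (real \<Rightarrow> real \<Rightarrow> real) \<Rightarrow> bool" where
  "C2_on_strip T u \<longleftrightarrow>
     C1_on_strip T u \<and> C1_on_strip T (d_t T u) \<and> C1_on_strip T (d_x u)"

definition classical_solution ::
    "real \<Rightarrow> (real \<Rightarrow> real) \<Rightarrow> (real \<Rightarrow> real) \<Rightarrow> (real \<Rightarrow> real \<Rightarrow> real) \<Rightarrow> bool" where
  "classical_solution T u\<^sub>0 u\<^sub>1 u \<longleftrightarrow>
     C2_on_strip T u \<and>
     (\<forall>t\<in>{0<..<T}. \<forall>x\<in>{0<..<1}.
        d_t T (d_t T u) t x - d_x (\<lambda>t x. x\<^sup>2 * d_x u t x) t x = 0) \<and>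
     (\<forall>t\<in>{0<..<T}. u t 1 = 0) \<and>
     (\<forall>t\<in>{0<..<T}. ((\<lambda>x. x\<^sup>2 * d_x u t x) \<longlongrightarrow> 0) (at_right 0)) \<and>
     (\<forall>x\<in>{0<..<1}. u 0 x = u\<^sub>0 x) \<and>
     (\<forall>x\<in>{0<..<1}. d_t T u 0 x = u\<^sub>1 x)"

definition energy :: "real \<Rightarrow> (real \<Rightarrow> real \<Rightarrow> real) \<Rightarrow> real \<Rightarrow> real" where
  "energy T u t =
     1 / 2 * integral {0<..<1} (\<lambda>x. (d_t T u t x)\<^sup>2 + x\<^sup>2 * (d_x u t x)\<^sup>2)"

definition observable :: "real \<Rightarrow> bool" where
  "observable T \<longleftrightarrow>
     (\<exists>C>0. \<forall>u\<^sub>0 u\<^sub>1 u.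
        test_function u\<^sub>0 \<longrightarrow> test_function u\<^sub>1 \<longrightarrow> classical_solution T u\<^sub>0 u\<^sub>1 u \<longrightarrow>
        integral {0..T} (\<lambda>t. (d_x u t 1)\<^sup>2) \<ge> C * energy T u 0)"

end

theory Submission
  imports Defs
begin

text \<open>
  In the coordinate \<open>y = - ln x\<close> the wave speed \<open>x\<close> becomes 1 and the degenerate point \<open>x = 0\<close>
  moves to infinity: with \<open>u = exp (y / 2) * w\<close> the equation turns into the Klein-Gordon
  equation \<open>w\<^sub>t\<^sub>t = w\<^sub>y\<^sub>y - w / 4\<close> on the half line \<open>y > 0\<close>. A signal starting at \<open>x\<close> therefore
  stays in \<open>[x * exp (- t), x * exp t]\<close>, so data supported in \<open>]0, b[\<close> with \<open>b * exp T < 1\<close> are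
  not felt at \<open>x = 1\<close> up to time \<open>T\<close>, whatever their energy. Since no finite time suffices for a
  signal to cross the whole interval, every \<open>T\<close> admits such data.

  For existence the Riemann function of the Klein-Gordon equation, an entire Bessel-type series
  (\<open>bessel_series\<close>), is written back in the variable \<open>x\<close>. This gives the solution
  \<open>U(t, x) = \<integral>\<^bsub>-t\<^esub>\<^bsup>t\<^esup> \<phi> (x * exp r) * M(t, r) dr\<close> with data \<open>(0, 2 \<phi>)\<close>, where \<open>M\<close> is the kernel
  \<open>riemann\<close>. That \<open>U\<close> solves the equation is an integration by parts in \<open>r\<close> (\<open>propagator_pde\<close>).
  Since the coefficients do not depend on time, \<open>U\<^sub>t\<close> is a solution too, with data \<open>(2 \<phi>, 0)\<close>.
  Hence \<open>sol \<phi> = (U + U\<^sub>t) / 2\<close> has both data equal to \<open>\<phi>\<close>, and it vanishes near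
  both ends of \<open>]0, 1]\<close> up to time \<open>T\<close> (\<open>sol_eq_0\<close>), which yields the boundary conditions and
  the vanishing normal derivative.

  Uniqueness also rests on finite speed: the energy in \<open>x > a * exp t\<close> cannot increase
  (\<open>local_energy_decreasing\<close>), because the inner end of this region moves along a
  characteristic and at \<open>x = 1\<close> no energy passes. Every point of the strip lies
  in such a region for small \<open>a\<close>, so solutions agree with no control of their behaviour as
  \<open>x\<close> tends to 0.

  Non-observability follows: the energy at time 0 of \<open>sol \<phi>\<close> is positive while its boundary
  observation is 0.
\<close>

section \<open>A smooth bump function\<close>

text \<open>Smoothness asks for derivatives of every order; exhibiting a class of functions that is closed
  under differentiation avoids computing them.\<close>

lemma smoothI:
  assumes "f \<in> S" "\<And>g. g \<in> S \<Longrightarrow> \<exists>g'\<in>S. \<forall>x. (g has_real_derivative g' x) (at x)"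
  shows "smooth f"
proof -
  have step: "deriv g \<in> S \<and> (\<forall>x. g differentiable (at x))" if "g \<in> S" for g
  proof -
    from assms(2)[OF that] obtain g' where g': "g' \<in> S" "\<And>x. (g has_real_derivative g' x) (at x)"
      by blast
    then have "deriv g = g'" by (auto intro: DERIV_imp_deriv)
    with g' show ?thesis by (auto simp: real_differentiable_def)
  qed
  have "(deriv ^^ n) f \<in> S" for n
    by (induction n) (use assms(1) step in auto)
  then show ?thesis using step unfolding smooth_def by blast
qed

text \<open>The exponent \<open>k\<close> makes the family closed under differentiation (\<open>flat_deriv\<close>), and by \<open>flat_Suc\<close>
  any power of \<open>s\<close> can be traded for a larger \<open>k\<close>. The two together keep all derivatives of
  \<open>flat 0\<close> after a polynomial in the shape polynomial times a single \<open>flat k\<close>.\<close>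

definition flat :: "nat \<Rightarrow> real \<Rightarrow> real" where
  "flat k s = (if s > 0 then exp (- (1 / s)) / s ^ k else 0)"

lemma flat_Suc: "s * flat (Suc k) s = flat k s"
  by (simp add: flat_def)

lemma flat_tendsto_0: "(flat k \<longlongrightarrow> 0) (at 0)"
proof (rule filterlim_split_at)
  show "(flat k \<longlongrightarrow> 0) (at_left 0)"
    by (rule tendsto_eventually) (auto simp: flat_def eventually_at_filter)
  have "((\<lambda>s::real. inverse s ^ k / exp (inverse s)) \<longlongrightarrow> 0) (at_right 0)"
    by (rule filterlim_compose[OF tendsto_power_div_exp_0 filterlim_inverse_at_top_right])
  moreover have "\<forall>\<^sub>F s in at_right 0. inverse s ^ k / exp (inverse s) = flat k s"
    by (auto simp: flat_def eventually_at_filter divide_inverse exp_minus power_inverse)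
  ultimately show "(flat k \<longlongrightarrow> 0) (at_right 0)"
    by (rule Lim_transform_eventually)
qed

lemma flat_deriv:
  "(flat k has_real_derivative flat (Suc (Suc k)) s - real k * flat (Suc k) s) (at s)"
proof -
  consider "s < 0" | "s = 0" | "s > 0" by linarith
  then show ?thesis
  proof cases
    case 1
    have "((\<lambda>_. 0) has_real_derivative 0) (at s)" by simp
    then have "(flat k has_real_derivative 0) (at s)"
      by (rule has_field_derivative_transform_within_open[where S = "{..<0}"])
         (use 1 in \<open>auto simp: flat_def\<close>)
    with 1 show ?thesis by (simp add: flat_def)
  next
    case 2
    have "((\<lambda>h. (flat k (0 + h) - flat k 0) / h) \<longlongrightarrow> 0) (at 0)"
      by (rule Lim_transform_eventually[OF flat_tendsto_0[of "Suc k"]])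
         (auto simp: flat_def eventually_at_filter)
    with 2 show ?thesis by (simp add: DERIV_def flat_def)
  next
    case 3
    have "((\<lambda>s. exp (- (1 / s)) / s ^ k) has_real_derivative
            flat (Suc (Suc k)) s - real k * flat (Suc k) s) (at s)"
    proof (rule DERIV_cong)
      show "((\<lambda>s. exp (- (1 / s)) / s ^ k) has_real_derivative
          (exp (- (1 / s)) * (1 / s\<^sup>2) * s ^ k - exp (- (1 / s)) * (real k * s ^ (k - 1))) /
          (s ^ k * s ^ k)) (at s)"
        using 3 by (auto intro!: derivative_eq_intros simp: power2_eq_square)
      have alg: "(e * (1 / s\<^sup>2) * P - e * (real k * P / s)) / (P * P)
          = e / (s * (s * P)) - real k * (e / (s * P))"
        if "P \<noteq> 0" for e P :: real
        using that 3 by (simp add: divide_simps power2_eq_square) (simp add: algebra_simps)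
      have "real k * s ^ (k - 1) = real k * s ^ k / s"
        using 3 by (cases k) auto
      then show "(exp (- (1 / s)) * (1 / s\<^sup>2) * s ^ k - exp (- (1 / s)) * (real k * s ^ (k - 1))) /
          (s ^ k * s ^ k) = flat (Suc (Suc k)) s - real k * flat (Suc k) s"
        using alg[of "s ^ k"] 3 by (simp add: flat_def)
    qed
    then show ?thesis
      by (rule has_field_derivative_transform_within_open[where S = "{0<..}"])
         (use 3 in \<open>auto simp: flat_def\<close>)
  qed
qed

text \<open>Writing the lower terms of the derivative with \<open>flat_Suc\<close> as multiples of \<open>flat (k + 2)\<close> shows
  that the class of these products, for a fixed polynomial \<open>q\<close>, contains its derivatives. No case
  distinction at the zeros of \<open>q\<close> is needed, since \<open>flat\<close> has absorbed it.\<close>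

lemma smooth_flat_poly: "smooth (\<lambda>x. poly p x * flat k (poly q x))"
proof (rule smoothI[where S = "{f. \<exists>p k. f = (\<lambda>x. poly p x * flat k (poly q x))}"], blast, clarify)
  fix p k
  let ?p' = "pderiv p * q\<^sup>2 + p * pderiv q - of_nat k * p * pderiv q * q"
  have "((\<lambda>x. poly p x * flat k (poly q x)) has_real_derivative
          poly ?p' x * flat (Suc (Suc k)) (poly q x)) (at x)" for x
  proof -
    have "((\<lambda>x. poly p x * flat k (poly q x)) has_real_derivative
       poly (pderiv p) x * flat k (poly q x) + poly p x *
       ((flat (Suc (Suc k)) (poly q x) - real k * flat (Suc k) (poly q x)) * poly (pderiv q) x)) (at x)"
      by (rule derivative_eq_intros DERIV_chain2[OF flat_deriv] poly_DERIV refl)+ (simp add: mult_ac)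
    moreover have "flat k (poly q x) = poly q x * (poly q x * flat (Suc (Suc k)) (poly q x))"
        "flat (Suc k) (poly q x) = poly q x * flat (Suc (Suc k)) (poly q x)"
      by (simp_all only: flat_Suc)
    ultimately show ?thesis by (simp add: algebra_simps power2_eq_square)
  qed
  then show "\<exists>g'\<in>{f. \<exists>p k. f = (\<lambda>x. poly p x * flat k (poly q x))}.
      \<forall>x. ((\<lambda>x. poly p x * flat k (poly q x)) has_real_derivative g' x) (at x)"
    by (intro bexI[where x = "\<lambda>x. poly ?p' x * flat (Suc (Suc k)) (poly q x)"]) blast+
qed

definition bump :: "real \<Rightarrow> real \<Rightarrow> real \<Rightarrow> real" where
  "bump a b x = flat 0 ((x - a) * (b - x))"

lemma smooth_bump: "smooth (bump a b)"
proof -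
  have "bump a b = (\<lambda>x. poly 1 x * flat 0 (poly ([:- a, 1:] * [:b, - 1:]) x))"
    by (auto simp: bump_def fun_eq_iff algebra_simps)
  then show ?thesis by (simp only: smooth_flat_poly)
qed

lemma bump_eq_0_iff: "a < b \<Longrightarrow> bump a b x = 0 \<longleftrightarrow> x \<notin> {a<..<b}"
  by (auto simp: bump_def flat_def zero_less_mult_iff)

lemma test_function_bump:
  assumes "0 < a" "a < b" "b < 1" shows "test_function (bump a b)"
proof -
  have "{x. bump a b x \<noteq> 0} = {a<..<b}" unfolding bump_eq_0_iff[OF assms(2)] by blast
  then have "closure {x. bump a b x \<noteq> 0} = {a..b}" using assms(2) by simp
  then show ?thesis using assms smooth_bump unfolding test_function_def by force
qed

lemma smooth_deriv: "smooth f \<Longrightarrow> smooth (deriv f)"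
  unfolding smooth_def
proof (intro allI)
  fix n x
  assume "\<forall>n x. (deriv ^^ n) f differentiable at x"
  then have "(deriv ^^ Suc n) f differentiable at x" by blast
  then show "(deriv ^^ n) (deriv f) differentiable at x" by (simp only: funpow_Suc_right o_apply)
qed

lemma smooth_has_derivative: "smooth f \<Longrightarrow> (f has_real_derivative deriv f x) (at x)"
  using smooth_def[of f] DERIV_deriv_iff_real_differentiable[of f x]
  by (auto dest: spec[where x = 0])

lemma smooth_continuous: "smooth f \<Longrightarrow> continuous_on S f"
  by (intro continuous_at_imp_continuous_on ballI DERIV_isCont[OF smooth_has_derivative])

section \<open>The entire series behind the Riemann function\<close>

text \<open>Up to normalisation this is a modified Bessel function: for \<open>z > 0\<close> it equals
  \<open>z powr (- k / 2)\<close> times the modified Bessel function of order \<open>k\<close> at \<open>2 * sqrt z\<close>. It is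
  entire in \<open>z\<close>, hence smooth at \<open>z = 0\<close>, the value taken on the characteristics.\<close>

definition bessel_series :: "nat \<Rightarrow> real \<Rightarrow> real" where
  "bessel_series k z = (\<Sum>n. z ^ n / (fact n * fact (n + k)))"

lemma fact_Suc_cancel: "real (Suc n) * (c / (fact (Suc n) * d)) = c / (fact n * d)"
  unfolding fact_Suc by (simp del: of_nat_Suc)

lemma summable_bessel_series: "summable (\<lambda>n. (1 / (fact n * fact (n + k))) * (z::real) ^ n)"
proof (rule summable_comparison_test'[OF summable_exp[of "\<bar>z\<bar>"]])
  fix n :: nat
  have "1 \<le> (fact (n + k) :: real)" by simp
  then have "(fact n :: real) \<le> fact n * fact (n + k)" by (simp add: mult_le_cancel_left1)
  then have "1 / (fact n * fact (n + k)) \<le> (inverse (fact n) :: real)"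
    by (simp add: field_simps)
  then have "1 / (fact n * fact (n + k)) * \<bar>z\<bar> ^ n \<le> inverse (fact n) * \<bar>z\<bar> ^ n"
    by (rule mult_right_mono) simp
  then show "norm (1 / (fact n * fact (n + k)) * z ^ n) \<le> inverse (fact n) * \<bar>z\<bar> ^ n"
    by (simp add: abs_mult power_abs)
qed

lemma bessel_series_deriv: "(bessel_series k has_real_derivative bessel_series (Suc k) z) (at z)"
proof -
  have "diffs (\<lambda>n. 1 / (fact n * fact (n + k)) :: real) = (\<lambda>n. 1 / (fact n * fact (n + Suc k)))"
    unfolding diffs_def fact_Suc_cancel by simp
  then show ?thesis
    using termdiffs_strong_converges_everywhere[OF summable_bessel_series[of k], of z]
    by (simp add: bessel_series_def[abs_def])
qed

text \<open>Bessel's differential equation \<open>z * f'' + f' = f\<close> for \<open>f = bessel_series 0\<close>, in view of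
  \<open>bessel_series_deriv\<close>. It is what makes the kernel below solve a wave equation.\<close>

lemma bessel_series_ode: "z * bessel_series 2 z + bessel_series 1 z = bessel_series 0 z"
proof -
  define c where "c k n = z ^ n / (fact n * fact (n + k))" for k n
  have s: "summable (c k)" for k
    using summable_bessel_series[of k z] by (simp add: c_def[abs_def])
  have b: "bessel_series k z = suminf (c k)" for k
    by (simp add: bessel_series_def c_def[abs_def])
  have c1: "c 0 n - c 1 n = real n * c 1 n" for n
  proof -
    have "c 0 n = real (Suc n) * c 1 n"
      using fact_Suc_cancel[of n "z ^ n" "fact n"] by (simp add: c_def mult.commute)
    then show ?thesis by (simp add: algebra_simps)
  qed
  have c2: "real (Suc n) * c 1 (Suc n) = z * c 2 n" for n
    using fact_Suc_cancel[of n "z ^ Suc n" "fact (n + 2)"] by (simp add: c_def)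
  have sd: "summable (\<lambda>n. real n * c 1 n)"
    using summable_diff[OF s[of 0] s[of 1]] by (simp only: c1)
  have "bessel_series 0 z - bessel_series 1 z = (\<Sum>n. real n * c 1 n)"
    unfolding b suminf_diff[OF s s] c1 ..
  also have "\<dots> = (\<Sum>n. real (Suc n) * c 1 (Suc n))"
    using suminf_split_head[OF sd] by simp
  also have "\<dots> = z * bessel_series 2 z"
    unfolding c2 b by (rule suminf_mult[OF s])
  finally show ?thesis by simp
qed

section \<open>Continuously differentiable functions on the plane\<close>

definition partials :: "(real \<Rightarrow> real \<Rightarrow> real) \<Rightarrow> (real \<Rightarrow> real \<Rightarrow> real) \<Rightarrow> (real \<Rightarrow> real \<Rightarrow> real) \<Rightarrow> bool" where
  "partials f ft fx \<longleftrightarrow>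
     (\<forall>t x. ((\<lambda>s. f s x) has_real_derivative ft t x) (at t) \<and> (f t has_real_derivative fx t x) (at x)) \<and>
     continuous_on UNIV (\<lambda>(t, x). ft t x) \<and> continuous_on UNIV (\<lambda>(t, x). fx t x)"

lemma continuous_on_binary:
  assumes "continuous_on UNIV (\<lambda>(t, x). f t x)" "continuous_on S g" "continuous_on S h"
  shows "continuous_on S (\<lambda>z. f (g z) (h z))"
  using continuous_on_compose2[OF assms(1) continuous_on_Pair[OF assms(2,3)]] by simp

text \<open>Continuity of one partial derivative already upgrades the partial derivatives to a total one;
  joint continuity of the function and the chain rule along curves follow from it.\<close>

lemma partials_has_derivative:
  assumes "partials f ft fx"
  shows "((\<lambda>(t, x). f t x) has_derivative (\<lambda>(h, k). ft t x * h + fx t x * k)) (at (t, x))"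
proof -
  have c: "continuous_on UNIV (\<lambda>p. fx (fst p) (snd p))"
    using assms by (simp add: partials_def case_prod_unfold)
  have "((\<lambda>(t, x). f t x) has_derivative (\<lambda>(h, k). ft t x * h + blinfun_mult_right (fx t x) k))
          (at (t, x) within UNIV \<times> UNIV)"
  proof (rule has_derivative_partialsI)
    show "((\<lambda>s. f s x) has_derivative (\<lambda>h. ft t x * h)) (at t within UNIV)"
      using assms by (simp add: partials_def has_field_derivative_def)
    show "(f s has_derivative blinfun_apply (blinfun_mult_right (fx s y))) (at y within UNIV)" for s y
      using assms by (simp add: partials_def has_field_derivative_def blinfun_mult_right.rep_eq)
    have "continuous_on UNIV (\<lambda>p. blinfun_mult_right (fx (fst p) (snd p)))"
      by (intro continuous_intros c)
    then show "continuous (at (t, x) within UNIV \<times> UNIV) (\<lambda>(x, y). blinfun_mult_right (fx x y))"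
      by (simp add: continuous_on_eq_continuous_at case_prod_unfold)
  qed auto
  then show ?thesis by (simp add: blinfun_mult_right.rep_eq)
qed

lemma partials_chain:
  assumes "partials f ft fx"
    and "(a has_real_derivative a') (at s)" "(b has_real_derivative b') (at s)"
  shows "((\<lambda>s. f (a s) (b s)) has_real_derivative ft (a s) (b s) * a' + fx (a s) (b s) * b') (at s)"
proof -
  have "((\<lambda>s. (a s, b s)) has_derivative (\<lambda>h. (a' * h, b' * h))) (at s)"
    using assms(2,3) by (auto simp: has_field_derivative_def intro!: has_derivative_Pair)
  from has_derivative_compose[OF this partials_has_derivative[OF assms(1)]]
  show ?thesis
    unfolding has_field_derivative_def
    by (auto elim!: has_derivative_eq_rhs simp: algebra_simps)
qed

lemma partials_continuous:
  assumes "partials f ft fx" shows "continuous_on UNIV (\<lambda>(t, x). f t x)"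
proof (rule continuous_at_imp_continuous_on, clarify)
  fix t x show "isCont (\<lambda>(t, x). f t x) (t, x)"
    using has_derivative_continuous[OF partials_has_derivative[OF assms]] .
qed

lemma partials_continuousD:
  assumes "partials f ft fx"
  shows "continuous_on UNIV (\<lambda>(t, x). f t x)" "continuous_on UNIV (\<lambda>(t, x). ft t x)"
    "continuous_on UNIV (\<lambda>(t, x). fx t x)"
  using assms partials_continuous[OF assms] by (auto simp: partials_def)

lemma partialsD:
  assumes "partials f ft fx"
  shows "((\<lambda>s. f s x) has_real_derivative ft t x) (at t)" "(f t has_real_derivative fx t x) (at x)"
  using assms by (auto simp: partials_def)

lemma partials_add:
  assumes "partials f ft fx" "partials g gt gx"
  shows "partials (\<lambda>t x. f t x + g t x) (\<lambda>t x. ft t x + gt t x) (\<lambda>t x. fx t x + gx t x)"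
  using assms unfolding partials_def
  by (auto intro!: derivative_intros continuous_intros simp: case_prod_unfold)

lemma partials_mult:
  assumes "partials f ft fx" "partials g gt gx"
  shows "partials (\<lambda>t x. f t x * g t x) (\<lambda>t x. ft t x * g t x + gt t x * f t x)
           (\<lambda>t x. fx t x * g t x + gx t x * f t x)"
  using assms partials_continuous[OF assms(1)] partials_continuous[OF assms(2)] unfolding partials_def
  by (auto intro!: DERIV_mult continuous_intros simp: case_prod_unfold)

lemma partials_only_x:
  assumes "\<And>x. (g has_real_derivative g' x) (at x)" "continuous_on UNIV g'"
  shows "partials (\<lambda>t x. g x) (\<lambda>t x. 0) (\<lambda>t x. g' x)"
  unfolding partials_def case_prod_unfold
  by (auto intro!: assms(1) continuous_on_compose2[OF assms(2)] continuous_intros)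

section \<open>Integrals along multiplicative rays\<close>

text \<open>For \<open>t > 0\<close> this is \<open>\<integral>\<^bsub>-t\<^esub>\<^bsup>t\<^esup> \<psi> (x * exp r) * M(t, r) dr\<close>, rescaled to a fixed interval. The
  rescaled form is as smooth for all real \<open>t\<close> as \<open>\<psi>\<close> and \<open>M\<close> are, so no one-sided derivatives at \<open>t = 0\<close>
  are involved, and differentiation under the integral applies.\<close>

definition ray_integral :: "(real \<Rightarrow> real) \<Rightarrow> (real \<Rightarrow> real \<Rightarrow> real) \<Rightarrow> real \<Rightarrow> real \<Rightarrow> real" where
  "ray_integral \<psi> M t x = t * integral {-1..1} (\<lambda>s. \<psi> (x * exp (t * s)) * M t (t * s))"

lemma partials_integral:
  fixes f ft fx :: "real \<Rightarrow> real \<Rightarrow> real \<Rightarrow> real"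
  assumes f: "\<And>s t x. s \<in> {a..b} \<Longrightarrow> ((\<lambda>t. f t x s) has_real_derivative ft t x s) (at t)"
      "\<And>s t x. s \<in> {a..b} \<Longrightarrow> ((\<lambda>x. f t x s) has_real_derivative fx t x s) (at x)"
    and cont: "continuous_on UNIV (\<lambda>z. f (fst (fst z)) (snd (fst z)) (snd z))"
      "continuous_on UNIV (\<lambda>z. ft (fst (fst z)) (snd (fst z)) (snd z))"
      "continuous_on UNIV (\<lambda>z. fx (fst (fst z)) (snd (fst z)) (snd z))"
  shows "partials (\<lambda>t x. integral {a..b} (f t x)) (\<lambda>t x. integral {a..b} (ft t x))
            (\<lambda>t x. integral {a..b} (fx t x))"
proof -
  have c: "continuous_on S (\<lambda>z. g (p z) (q z) (r z))"
    if "continuous_on UNIV (\<lambda>z. g (fst (fst z)) (snd (fst z)) (snd z))"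
      "continuous_on S p" "continuous_on S q" "continuous_on S r"
    for S :: "'b::topological_space set" and g :: "real \<Rightarrow> real \<Rightarrow> real \<Rightarrow> real" and p q r
    using continuous_on_compose2[OF that(1) continuous_on_Pair[OF continuous_on_Pair[OF that(2,3)]
        that(4)]]
    by simp
  have int: "f t x integrable_on cbox a b" for t x
    by (rule integrable_continuous, rule c[OF cont(1)]) (intro continuous_intros)+
  have "((\<lambda>t. integral (cbox a b) (f t x)) has_real_derivative integral (cbox a b) (ft t x))
          (at t within UNIV)" for t x
    by (rule leibniz_rule_field_derivative)
       (auto intro!: f(1) int[simplified] c[OF cont(2)] continuous_intros simp: case_prod_unfold)
  moreover have "((\<lambda>x. integral (cbox a b) (f t x)) has_real_derivative integral (cbox a b) (fx t x))
          (at x within UNIV)" for t x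
    by (rule leibniz_rule_field_derivative)
       (auto intro!: f(2) int[simplified] c[OF cont(3)] continuous_intros simp: case_prod_unfold)
  moreover have "continuous_on UNIV (\<lambda>z. integral (cbox a b) (ft (fst z) (snd z)))"
    "continuous_on UNIV (\<lambda>z. integral (cbox a b) (fx (fst z) (snd z)))"
    by (rule integral_continuous_on_param, unfold case_prod_unfold,
        intro c[OF cont(2)] c[OF cont(3)] continuous_intros)+
  ultimately show ?thesis
    by (simp add: partials_def case_prod_unfold)
qed

text \<open>The time derivative is that of an integral over the moving interval \<open>[-t, t]\<close>: two endpoint
  terms and the integral of the differentiated kernel. In the rescaled form the remaining terms
  combine to the \<open>s\<close>-derivative of \<open>s\<close> times the integrand, whose integral gives the endpoint
  terms. The space derivative keeps the form of the integral, at the price of a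
  factor \<open>exp r\<close> in the kernel.\<close>

lemma partials_ray_integral:
  assumes \<psi>: "\<And>y. (\<psi> has_real_derivative \<psi>' y) (at y)" "continuous_on UNIV \<psi>'"
    and M: "partials M Mt Mr"
  shows "partials (ray_integral \<psi> M)
     (\<lambda>t x. \<psi> (x * exp t) * M t t + \<psi> (x * exp (- t)) * M t (- t) + ray_integral \<psi> Mt t x)
     (ray_integral \<psi>' (\<lambda>t r. exp r * M t r))"
proof -
  have c\<psi>: "continuous_on UNIV \<psi>"
    by (intro continuous_at_imp_continuous_on ballI DERIV_isCont[OF \<psi>(1)])
  note cont = continuous_on_compose2[OF c\<psi>] continuous_on_compose2[OF \<psi>(2)]
    partials_continuousD[OF M, THEN continuous_on_binary] continuous_intros
  define f where "f t x s = \<psi> (x * exp (t * s)) * M t (t * s)" for t x s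
  define ft where "ft t x s = \<psi>' (x * exp (t * s)) * (x * exp (t * s) * s) * M t (t * s)
     + (Mt t (t * s) + Mr t (t * s) * s) * \<psi> (x * exp (t * s))" for t x s
  define fx where "fx t x s = \<psi>' (x * exp (t * s)) * (exp (t * s) * M t (t * s))" for t x s
  define fs where "fs t x s = \<psi>' (x * exp (t * s)) * (x * exp (t * s) * t) * M t (t * s)
     + (Mr t (t * s) * t) * \<psi> (x * exp (t * s))" for t x s
  have dt: "((\<lambda>t. f t x s) has_real_derivative ft t x s) (at t)" for t x s
    unfolding f_def ft_def
    by (rule DERIV_mult DERIV_chain2[OF \<psi>(1)] partials_chain[OF M, THEN DERIV_cong]
        derivative_eq_intros refl)+
       simp_all
  have dx: "((\<lambda>x. f t x s) has_real_derivative fx t x s) (at x)" for t x s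
    unfolding f_def fx_def
    by (rule DERIV_chain2[OF \<psi>(1)] derivative_eq_intros refl)+ simp
  have ds: "(f t x has_real_derivative fs t x s) (at s)" for t x s
    unfolding f_def[abs_def] fs_def
    by (rule DERIV_mult DERIV_chain2[OF \<psi>(1)] partials_chain[OF M, THEN DERIV_cong]
        derivative_eq_intros refl)+
       simp_all
  have cf: "continuous_on UNIV (\<lambda>z. f (fst (fst z)) (snd (fst z)) (snd z))"
    unfolding f_def by (intro cont) auto
  have cft: "continuous_on UNIV (\<lambda>z. ft (fst (fst z)) (snd (fst z)) (snd z))"
    unfolding ft_def by (intro cont) auto
  have cfx: "continuous_on UNIV (\<lambda>z. fx (fst (fst z)) (snd (fst z)) (snd z))"
    unfolding fx_def by (intro cont) auto
  have int: "partials (\<lambda>t x. integral {-1..1} (f t x)) (\<lambda>t x. integral {-1..1} (ft t x))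
            (\<lambda>t x. integral {-1..1} (fx t x))"
    by (rule partials_integral[OF dt dx cf cft cfx])
  have "partials (\<lambda>t x. t) (\<lambda>t x. 1) (\<lambda>t x. 0)"
    by (auto simp: partials_def case_prod_unfold)
  from partials_mult[OF this int]
  have main: "partials (ray_integral \<psi> M) (\<lambda>t x. integral {-1..1} (f t x) +
      integral {-1..1} (ft t x) * t)
       (\<lambda>t x. integral {-1..1} (fx t x) * t)"
    by (simp add: ray_integral_def[abs_def] f_def[abs_def])
  have "integral {-1..1} (f t x) + integral {-1..1} (ft t x) * t =
     \<psi> (x * exp t) * M t t + \<psi> (x * exp (- t)) * M t (- t) + ray_integral \<psi> Mt t x" for t x
  proof -
    \<comment> \<open>The integrand is the derivative of \<open>s * f t x s\<close>.\<close>
    have "((\<lambda>s. 1 * f t x s + fs t x s * s) has_integral 1 * f t x 1 - (-1) * f t x (-1)) {-1..1}"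
      using DERIV_mult[OF DERIV_ident ds]
      by (intro fundamental_theorem_of_calculus)
         (auto intro: has_vector_derivative_at_within
           simp: has_real_derivative_iff_has_vector_derivative)
    then have "integral {-1..1} (\<lambda>s. f t x s + fs t x s * s) = f t x 1 + f t x (-1)"
      by (simp add: integral_unique)
    moreover have "integral {-1..1} (\<lambda>s. f t x s + t * ft t x s) =
        integral {-1..1} (\<lambda>s. f t x s + fs t x s * s) +
        integral {-1..1} (\<lambda>s. t * (\<psi> (x * exp (t * s)) * Mt t (t * s)))"
      by (subst integral_add[symmetric])
         (auto intro!: integrable_continuous_real cont arg_cong[where f = "integral _"]
            simp: f_def fs_def ft_def algebra_simps)
    moreover have "integral {-1..1} (\<lambda>s. f t x s + t * ft t x s) =
       integral {-1..1} (f t x) + integral {-1..1} (ft t x) * t"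
      by (subst integral_add)
         (auto intro!: integrable_continuous_real cont simp: f_def[abs_def] ft_def[abs_def])
    ultimately show ?thesis by (simp add: ray_integral_def f_def)
  qed
  moreover have "integral {-1..1} (fx t x) * t = ray_integral \<psi>' (\<lambda>t r. exp r * M t r) t x" for t x
    unfolding ray_integral_def fx_def[abs_def] by (rule mult.commute)
  ultimately show ?thesis using main by simp
qed

section \<open>The Riemann function\<close>

text \<open>The Riemann function \<open>bessel_series 0 ((r\<^sup>2 - t\<^sup>2) / 16)\<close> of the Klein-Gordon equation
  \<open>w\<^sub>t\<^sub>t = w\<^sub>r\<^sub>r - w / 4\<close>, multiplied by the factor \<open>exp (r / 2)\<close> that relates this equation to the
  degenerate one.\<close>

definition riemann :: "real \<Rightarrow> real \<Rightarrow> real" where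
  "riemann t r = exp (r / 2) * bessel_series 0 ((r\<^sup>2 - t\<^sup>2) / 16)"
definition riemann_t :: "real \<Rightarrow> real \<Rightarrow> real" where
  "riemann_t t r = exp (r / 2) * (- (t / 8) * bessel_series 1 ((r\<^sup>2 - t\<^sup>2) / 16))"
definition riemann_r :: "real \<Rightarrow> real \<Rightarrow> real" where
  "riemann_r t r = exp (r / 2) * (bessel_series 0 ((r\<^sup>2 - t\<^sup>2) / 16) / 2 +
      r / 8 * bessel_series 1 ((r\<^sup>2 - t\<^sup>2) / 16))"
definition riemann_tt :: "real \<Rightarrow> real \<Rightarrow> real" where
  "riemann_tt t r = exp (r / 2) *
     (t\<^sup>2 / 64 * bessel_series 2 ((r\<^sup>2 - t\<^sup>2) / 16) - bessel_series 1 ((r\<^sup>2 - t\<^sup>2) / 16) / 8)"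
definition riemann_tr :: "real \<Rightarrow> real \<Rightarrow> real" where
  "riemann_tr t r = exp (r / 2) *
     (- (t / 16) * bessel_series 1 ((r\<^sup>2 - t\<^sup>2) / 16) - t * r / 64 * bessel_series 2 ((r\<^sup>2 - t\<^sup>2) / 16))"

lemma bessel_series_0 [simp]: "bessel_series k 0 = 1 / fact k"
proof -
  have "(\<lambda>n. (0::real) ^ n / (fact n * fact (n + k))) sums (0 ^ 0 / (fact 0 * fact (0 + k)))"
    using sums_finite[of "{0}" "\<lambda>n. (0::real) ^ n / (fact n * fact (n + k))"] by simp
  then show ?thesis by (simp add: bessel_series_def sums_iff)
qed

lemma continuous_bessel_series: "continuous_on S f \<Longrightarrow> continuous_on S (\<lambda>z. bessel_series k (f z))"
  by (rule continuous_on_compose2[of UNIV "bessel_series k"])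
     (auto intro: continuous_at_imp_continuous_on DERIV_isCont[OF bessel_series_deriv])

lemma bessel_series_derivs:
  "(bessel_series 0 has_real_derivative bessel_series 1 z) (at z)"
  "(bessel_series 1 has_real_derivative bessel_series 2 z) (at z)"
  using bessel_series_deriv[of 0 z] bessel_series_deriv[of 1 z] by (simp_all add: numeral_2_eq_2)

lemma partials_riemann: "partials riemann riemann_t riemann_r"
  unfolding partials_def case_prod_unfold
proof (intro conjI allI)
  show "((\<lambda>s. riemann s r) has_real_derivative riemann_t t r) (at t)" for t r
    unfolding riemann_def riemann_t_def
    by (rule derivative_eq_intros DERIV_chain2[OF bessel_series_derivs(1)] refl | simp)+
  show "(riemann t has_real_derivative riemann_r t r) (at r)" for t r
    unfolding riemann_def[abs_def] riemann_r_def
    by (rule derivative_eq_intros DERIV_chain2[OF bessel_series_derivs(1)] refl | simp)+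
        (simp add: field_simps)
qed (auto simp: riemann_t_def riemann_r_def intro!: continuous_intros continuous_bessel_series)

lemma partials_riemann_t: "partials riemann_t riemann_tt riemann_tr"
  unfolding partials_def case_prod_unfold
proof (intro conjI allI)
  show "((\<lambda>s. riemann_t s r) has_real_derivative riemann_tt t r) (at t)" for t r
    unfolding riemann_t_def riemann_tt_def
    by (rule derivative_eq_intros DERIV_chain2[OF bessel_series_derivs(2)] refl | simp)+
       (simp add: field_simps power2_eq_square)
  show "(riemann_t t has_real_derivative riemann_tr t r) (at r)" for t r
    unfolding riemann_t_def[abs_def] riemann_tr_def
    by (rule derivative_eq_intros DERIV_chain2[OF bessel_series_derivs(2)] refl | simp)+
       (simp add: field_simps power2_eq_square)
qed (auto simp: riemann_tt_def riemann_tr_def intro!: continuous_intros continuous_bessel_series)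

text \<open>The kernel solves the adjoint equation \<open>M\<^sub>t\<^sub>t = M\<^sub>r\<^sub>r - M\<^sub>r\<close>: the operator \<open>u \<mapsto> (x\<^sup>2 u\<^sub>x)\<^sub>x\<close>, applied
  to \<open>x \<mapsto> \<psi> (x * exp r)\<close>, acts as \<open>p \<mapsto> p'' + p'\<close> in the variable \<open>r\<close>, and the adjoint of this is
  \<open>M \<mapsto> M'' - M'\<close>.\<close>

lemma riemann_r_deriv: "(riemann_r t has_real_derivative riemann_tt t r + riemann_r t r) (at r)"
proof (rule DERIV_cong)
  let ?z = "(r\<^sup>2 - t\<^sup>2) / 16"
  show "(riemann_r t has_real_derivative exp (r / 2) * (bessel_series 0 ?z / 4 +
      r / 8 * bessel_series 1 ?z + bessel_series 1 ?z / 8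
          + r\<^sup>2 / 64 * bessel_series 2 ?z)) (at r)"
    unfolding riemann_r_def[abs_def]
    by (rule derivative_eq_intros DERIV_chain2[OF bessel_series_derivs(1)] DERIV_chain2[OF
        bessel_series_derivs(2)] refl | simp)+
       (simp add: field_simps power2_eq_square)
  show "exp (r / 2) * (bessel_series 0 ?z / 4 + r / 8 * bessel_series 1 ?z + bessel_series 1 ?z / 8
      + r\<^sup>2 / 64 * bessel_series 2 ?z)
      = riemann_tt t r + riemann_r t r"
  proof -
    have "(r\<^sup>2 - t\<^sup>2) * bessel_series 2 ?z = 16 * (bessel_series 0 ?z - bessel_series 1 ?z)"
      using bessel_series_ode[of ?z] by simp
    then have "bessel_series 0 ?z / 4 + r / 8 * bessel_series 1 ?z + bessel_series 1 ?z / 8 +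
        r\<^sup>2 / 64 * bessel_series 2 ?z =
        (t\<^sup>2 / 64 * bessel_series 2 ?z - bessel_series 1 ?z / 8) + (bessel_series 0 ?z / 2 +
            r / 8 * bessel_series 1 ?z)"
      by (simp add: left_diff_distrib)
    then show ?thesis unfolding riemann_tt_def riemann_r_def distrib_left[symmetric] by (rule arg_cong)
  qed
qed

section \<open>The solution operator\<close>

text \<open>Each differentiation in \<open>x\<close> contributes a factor \<open>exp r\<close>, so \<open>j\<close> counts space derivatives.\<close>

definition weighted :: "real \<Rightarrow> (real \<Rightarrow> real \<Rightarrow> real) \<Rightarrow> real \<Rightarrow> real \<Rightarrow> real" where
  "weighted j M t r = exp (j * r) * M t r"

lemma partials_weighted:
  assumes "partials M Mt Mr"
  shows "partials (weighted j M) (weighted j Mt) (\<lambda>t r. j * exp (j * r) * M t r + Mr t r * exp (j * r))"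
proof -
  have "partials (\<lambda>t r. exp (j * r)) (\<lambda>t r. 0) (\<lambda>t r. j * exp (j * r))"
    by (rule partials_only_x) (auto intro!: derivative_eq_intros continuous_intros)
  from partials_mult[OF this assms] show ?thesis
    by (simp add: weighted_def[abs_def] mult.commute)
qed

lemma partials_ray_integral_weighted:
  assumes "smooth \<psi>" "partials M Mt Mr"
  shows "partials (ray_integral \<psi> (weighted j M))
     (\<lambda>t x. \<psi> (x * exp t) * weighted j M t t + \<psi> (x * exp (- t)) * weighted j M t (- t) +
         ray_integral \<psi> (weighted j Mt) t x)
     (ray_integral (deriv \<psi>) (weighted (j + 1) M))"
proof -
  have "(\<lambda>t r. exp r * weighted j M t r) = weighted (j + 1) M"
    by (auto simp: weighted_def fun_eq_iff algebra_simps exp_add)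
  then show ?thesis
    using partials_ray_integral[OF smooth_has_derivative[OF assms(1)] smooth_continuous[OF
        smooth_deriv[OF assms(1)]]
        partials_weighted[OF assms(2), of j]] by simp
qed

text \<open>The endpoint terms of the time derivative of the ray integral with kernel
  \<open>weighted j riemann\<close>. They are explicit since the Riemann function is constant on the
  characteristics \<open>r = t\<close> and \<open>r = - t\<close>.\<close>

definition endpoint_terms :: "real \<Rightarrow> (real \<Rightarrow> real) \<Rightarrow> real \<Rightarrow> real \<Rightarrow> real" where
  "endpoint_terms j \<psi> t x = \<psi> (x * exp t) * exp (j * t + t / 2) + \<psi> (x * exp (- t)) * exp (- (j * t
      + t / 2))"
definition endpoint_terms_t :: "real \<Rightarrow> (real \<Rightarrow> real) \<Rightarrow> real \<Rightarrow> real \<Rightarrow> real" where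
  "endpoint_terms_t j \<psi> t x =
     (deriv \<psi> (x * exp t) * (x * exp t) + \<psi> (x * exp t) * (j + 1 / 2)) * exp (j * t + t / 2) -
     (deriv \<psi> (x * exp (- t)) * (x * exp (- t)) + \<psi> (x * exp (- t)) * (j + 1 / 2)) * exp (- (j * t +
         t / 2))"

lemma partials_endpoint_terms:
  assumes "smooth \<psi>"
  shows "partials (endpoint_terms j \<psi>) (endpoint_terms_t j \<psi>) (endpoint_terms (j + 1) (deriv \<psi>))"
  unfolding partials_def case_prod_unfold
proof (intro conjI allI)
  note d = DERIV_chain2[OF smooth_has_derivative[OF assms]]
  note c = continuous_on_compose2[OF smooth_continuous[OF assms, of UNIV]]
    continuous_on_compose2[OF smooth_continuous[OF smooth_deriv[OF assms], of UNIV]]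
  show "((\<lambda>s. endpoint_terms j \<psi> s x) has_real_derivative endpoint_terms_t j \<psi> t x) (at t)" for t x
    unfolding endpoint_terms_def endpoint_terms_t_def
    by (rule derivative_eq_intros d refl | simp)+ (simp add: algebra_simps)
  show "(endpoint_terms j \<psi> t has_real_derivative endpoint_terms (j + 1) (deriv \<psi>) t x) (at x)" for t x
  proof -
    have e: "exp ((j + 1) * t + t / 2) = exp t * exp (j * t + t / 2)"
      "exp (- ((j + 1) * t + t / 2)) = exp (- t) * exp (- (j * t + t / 2))"
      by (simp_all add: algebra_simps flip: exp_add)
    show ?thesis
      unfolding endpoint_terms_def[abs_def] e by (rule derivative_eq_intros d refl)+ (simp add: mult_ac)
  qed
  show "continuous_on UNIV (\<lambda>p. endpoint_terms_t j \<psi> (fst p) (snd p))"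
    unfolding endpoint_terms_t_def by (intro continuous_intros c) auto
  show "continuous_on UNIV (\<lambda>p. endpoint_terms (j + 1) (deriv \<psi>) (fst p) (snd p))"
    unfolding endpoint_terms_def by (intro continuous_intros c) auto
qed

definition propagator :: "real \<Rightarrow> (real \<Rightarrow> real) \<Rightarrow> real \<Rightarrow> real \<Rightarrow> real" where
  "propagator j \<psi> = ray_integral \<psi> (weighted j riemann)"
definition propagator_t :: "real \<Rightarrow> (real \<Rightarrow> real) \<Rightarrow> real \<Rightarrow> real \<Rightarrow> real" where
  "propagator_t j \<psi> t x = endpoint_terms j \<psi> t x + ray_integral \<psi> (weighted j riemann_t) t x"
definition propagator_tt :: "real \<Rightarrow> (real \<Rightarrow> real) \<Rightarrow> real \<Rightarrow> real \<Rightarrow> real" where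
  "propagator_tt j \<psi> t x = endpoint_terms_t j \<psi> t x - t / 8 * endpoint_terms j \<psi> t x +
      ray_integral \<psi> (weighted j riemann_tt) t x"

lemma partials_propagator:
  assumes "smooth \<psi>"
  shows "partials (propagator j \<psi>) (propagator_t j \<psi>) (propagator (j + 1) (deriv \<psi>))"
proof -
  from partials_ray_integral_weighted[OF assms partials_riemann, of j]
  have "partials (propagator j \<psi>) (\<lambda>t x. \<psi> (x * exp t) * weighted j riemann t t +
      \<psi> (x * exp (- t)) * weighted j riemann t (- t) + ray_integral \<psi> (weighted j riemann_t) t x)
      (propagator (j + 1) (deriv \<psi>))" by (simp add: propagator_def)
  moreover have "\<psi> (x * exp t) * weighted j riemann t t +
      \<psi> (x * exp (- t)) * weighted j riemann t (- t) + ray_integral \<psi> (weighted j riemann_t) t x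
          = propagator_t j \<psi> t x"
    for t x
    by (simp add: propagator_t_def endpoint_terms_def weighted_def riemann_def flip: exp_add)
  ultimately show ?thesis by simp
qed

lemma partials_propagator_t:
  assumes "smooth \<psi>"
  shows "partials (propagator_t j \<psi>) (propagator_tt j \<psi>) (propagator_t (j + 1) (deriv \<psi>))"
proof -
  from partials_add[OF partials_endpoint_terms[OF assms, of j]
      partials_ray_integral_weighted[OF assms partials_riemann_t, of j]]
  have "partials (propagator_t j \<psi>) (\<lambda>t x. endpoint_terms_t j \<psi> t x +
      (\<psi> (x * exp t) * weighted j riemann_t t t + \<psi> (x * exp (- t)) * weighted j riemann_t t (- t) +
          ray_integral \<psi> (weighted j riemann_tt) t x))
      (propagator_t (j + 1) (deriv \<psi>))" by (simp add: propagator_t_def[abs_def])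
  moreover have "endpoint_terms_t j \<psi> t x + (\<psi> (x * exp t) * weighted j riemann_t t t +
      \<psi> (x * exp (- t)) * weighted j riemann_t t (- t) + ray_integral \<psi> (weighted j riemann_tt) t x)
          = propagator_tt j \<psi> t x"
    for t x
  proof -
    have "weighted j riemann_t t t = - (t / 8) * exp (j * t + t / 2)"
      by (simp add: weighted_def riemann_t_def exp_add)
    moreover have "weighted j riemann_t t (- t) = - (t / 8) * exp (- (j * t + t / 2))"
    proof -
      have e: "exp (- (j * t + t / 2)) = exp (j * (- t)) * exp (- t / 2)" by (simp flip: exp_add)
      show ?thesis unfolding e by (simp add: weighted_def riemann_t_def)
    qed
    ultimately show ?thesis
      by (simp only: propagator_tt_def endpoint_terms_def) (simp add: algebra_simps)
  qed
  ultimately show ?thesis by simp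
qed

text \<open>The right-hand side is \<open>(x\<^sup>2 U\<^sub>x)\<^sub>x\<close> for \<open>U = propagator 0 \<psi>\<close>. With \<open>p r = \<psi> (x * exp r)\<close> it is the integral
  of \<open>(p'' + p') * M\<close>. Moving the derivatives onto the kernel gives the integral of \<open>p * M\<^sub>t\<^sub>t\<close>
  and the boundary values of \<open>p' * M - p * M\<^sub>r + p * M\<close>, and the latter are exactly the endpoint
  terms that differentiating twice in time produces.\<close>

lemma propagator_pde:
  assumes "smooth \<psi>"
  shows "propagator_tt 0 \<psi> t x = x\<^sup>2 * propagator 2 (deriv (deriv \<psi>)) t x +
      2 * x * propagator 1 (deriv \<psi>) t x"
proof -
  let ?\<psi>1 = "deriv \<psi>" and ?\<psi>2 = "deriv (deriv \<psi>)"
  note sm = assms smooth_deriv[OF assms] smooth_deriv[OF smooth_deriv[OF assms]]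
  note c = continuous_on_compose2[OF smooth_continuous[OF sm(1), of UNIV]]
    continuous_on_compose2[OF smooth_continuous[OF sm(2), of UNIV]]
    continuous_on_compose2[OF smooth_continuous[OF sm(3), of UNIV]]
    partials_continuousD[OF partials_riemann, THEN continuous_on_binary]
    partials_continuousD[OF partials_riemann_t, THEN continuous_on_binary]
  define p where "p r = \<psi> (x * exp r)" for r
  define p1 where "p1 r = x * exp r * ?\<psi>1 (x * exp r)" for r
  define p2 where "p2 r = p1 r + (x * exp r)\<^sup>2 * ?\<psi>2 (x * exp r)" for r
  have dp: "(p has_real_derivative p1 r) (at r)" for r
    unfolding p_def p1_def
    by (rule DERIV_cong, rule DERIV_chain2[OF smooth_has_derivative[OF sm(1)]], rule DERIV_cmult,
        rule DERIV_exp) simp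
  have dp1: "(p1 has_real_derivative p2 r) (at r)" for r
    unfolding p1_def p2_def
    by (rule derivative_eq_intros DERIV_chain2[OF smooth_has_derivative[OF sm(2)]] refl | simp)+
       (simp add: power2_eq_square)
  \<comment> \<open>The boundary form of the integration by parts.\<close>
  define G where "G r = p1 r * riemann t r - p r * riemann_r t r + p r * riemann t r" for r
  have dG: "(G has_real_derivative (p2 r + p1 r) * riemann t r - p r * riemann_tt t r) (at r)" for r
    unfolding G_def
    by (rule derivative_eq_intros dp dp1 riemann_r_deriv partialsD(2)[OF partials_riemann] refl)+
       (simp add: algebra_simps)
  have "((\<lambda>s. ((p2 (t * s) +
      p1 (t * s)) * riemann t (t * s) - p (t * s) * riemann_tt t (t * s)) * t) has_integral
      G (t * 1) - G (t * (-1))) {-1..1}"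
  proof (rule fundamental_theorem_of_calculus)
    fix s :: real
    have "((\<lambda>s. G (t * s)) has_real_derivative
        ((p2 (t * s) + p1 (t * s)) * riemann t (t * s) - p (t * s) * riemann_tt t (t * s)) * t) (at s)"
      by (rule DERIV_chain2[OF dG]) (auto intro!: derivative_eq_intros)
    then show "((\<lambda>s. G (t * s)) has_vector_derivative
        ((p2 (t * s) + p1 (t * s)) * riemann t (t * s) - p (t * s) * riemann_tt t (t * s)) * t)
            (at s within {-1..1})"
      by (auto intro: has_vector_derivative_at_within
           simp: has_real_derivative_iff_has_vector_derivative)
  qed simp
  then have 1: "integral {-1..1} (\<lambda>s. ((p2 (t * s) +
      p1 (t * s)) * riemann t (t * s) - p (t * s) * riemann_tt t (t * s)) * t)
      = G t - G (- t)"
    by (drule_tac integral_unique) simp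
  have "x\<^sup>2 * propagator 2 ?\<psi>2 t x + 2 * x * propagator 1 ?\<psi>1 t x =
      t * (x\<^sup>2 * integral {-1..1} (\<lambda>s. ?\<psi>2 (x * exp (t * s)) * weighted 2 riemann t (t * s))
       + 2 * x * integral {-1..1} (\<lambda>s. ?\<psi>1 (x * exp (t * s)) * weighted 1 riemann t (t * s)))"
    by (simp add: propagator_def ray_integral_def algebra_simps)
  also have "\<dots> = t * integral {-1..1} (\<lambda>s. x\<^sup>2 * (?\<psi>2 (x * exp (t * s)) * weighted 2 riemann t (t * s))
       + 2 * x * (?\<psi>1 (x * exp (t * s)) * weighted 1 riemann t (t * s)))"
    by (subst integral_add) (auto intro!: integrable_continuous_real continuous_intros c simp:
        weighted_def)
  also have "\<dots> = t * integral {-1..1} (\<lambda>s. (p2 (t * s) + p1 (t * s)) * riemann t (t * s))"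
  proof -
    have "x\<^sup>2 * (?\<psi>2 (x * exp r) * weighted 2 riemann t r) +
        2 * x * (?\<psi>1 (x * exp r) * weighted 1 riemann t r) =
        (p2 r + p1 r) * riemann t r" for r
    proof -
      have e: "exp (2 * r) = exp r * exp r" by (simp flip: exp_add)
      show ?thesis unfolding p2_def p1_def weighted_def e by (simp add: algebra_simps power2_eq_square)
    qed
    then show ?thesis by simp
  qed
  also have "\<dots> = integral {-1..1} (\<lambda>s. ((p2 (t * s) +
      p1 (t * s)) * riemann t (t * s) - p (t * s) * riemann_tt t (t * s)) * t)
     + t * integral {-1..1} (\<lambda>s. p (t * s) * riemann_tt t (t * s))"
    unfolding integral_mult_left integral_mult_right
    by (subst integral_diff)
       (auto intro!: integrable_continuous_real continuous_intros c simp: p2_def p1_def p_def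
           algebra_simps)
  also have "\<dots> = G t - G (- t) + ray_integral \<psi> (weighted 0 riemann_tt) t x"
    unfolding 1 by (simp add: ray_integral_def p_def weighted_def)
  also have "G t - G (- t) = endpoint_terms_t 0 \<psi> t x - t / 8 * endpoint_terms 0 \<psi> t x"
    by (simp add: G_def riemann_def riemann_r_def p1_def p_def endpoint_terms_t_def
        endpoint_terms_def algebra_simps)
  finally show ?thesis by (simp add: propagator_tt_def)
qed

text \<open>Finite speed of propagation: only the values of \<open>\<psi>\<close> on \<open>[x * exp (- t), x * exp t]\<close> matter.\<close>

lemma propagator_eq_0:
  assumes "\<And>s. s \<in> {-1..1} \<Longrightarrow> \<psi> (x * exp (t * s)) = 0"
  shows "propagator j \<psi> t x = 0" "propagator_t j \<psi> t x = 0"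
proof -
  have "ray_integral \<psi> M t x = 0" for M
  proof -
    have "integral {-1..1} (\<lambda>s. \<psi> (x * exp (t * s)) * M t (t * s)) = integral {-1..1} (\<lambda>s::real. 0)"
      by (rule integral_cong) (use assms in auto)
    then show ?thesis by (simp add: ray_integral_def)
  qed
  then show "propagator j \<psi> t x = 0" "propagator_t j \<psi> t x = 0"
    using assms[of 1] assms[of "-1"] by (simp_all add: propagator_def propagator_t_def
        endpoint_terms_def)
qed

text \<open>The propagator alone has zero initial position and its time derivative has zero initial
  velocity. Their mean has \<open>\<phi>\<close> for both, so neither datum is trivial.\<close>

definition sol :: "(real \<Rightarrow> real) \<Rightarrow> real \<Rightarrow> real \<Rightarrow> real" where
  "sol \<phi> t x = (propagator 0 \<phi> t x + propagator_t 0 \<phi> t x) / 2"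
definition sol_t :: "(real \<Rightarrow> real) \<Rightarrow> real \<Rightarrow> real \<Rightarrow> real" where
  "sol_t \<phi> t x = (propagator_t 0 \<phi> t x + propagator_tt 0 \<phi> t x) / 2"
definition sol_x :: "(real \<Rightarrow> real) \<Rightarrow> real \<Rightarrow> real \<Rightarrow> real" where
  "sol_x \<phi> t x = (propagator 1 (deriv \<phi>) t x + propagator_t 1 (deriv \<phi>) t x) / 2"
definition sol_xx :: "(real \<Rightarrow> real) \<Rightarrow> real \<Rightarrow> real \<Rightarrow> real" where
  "sol_xx \<phi> t x = (propagator 2 (deriv (deriv \<phi>)) t x + propagator_t 2 (deriv (deriv \<phi>)) t x) / 2"

lemma partials_divide:
  assumes "partials f ft fx"
  shows "partials (\<lambda>t x. f t x / c) (\<lambda>t x. ft t x / c) (\<lambda>t x. fx t x / c)"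
  using assms unfolding partials_def case_prod_unfold divide_inverse
  by (auto intro!: continuous_intros DERIV_cmult_right)

lemma partials_sol:
  assumes "smooth \<phi>" shows "partials (sol \<phi>) (sol_t \<phi>) (sol_x \<phi>)"
  using partials_divide[OF partials_add[OF partials_propagator[OF assms, of 0]
      partials_propagator_t[OF assms, of 0]], of 2]
  by (simp add: sol_def[abs_def] sol_t_def[abs_def] sol_x_def[abs_def])

lemma partials_sol_x:
  assumes "smooth \<phi>" shows "\<exists>h. partials (sol_x \<phi>) h (sol_xx \<phi>)"
  using partials_divide[OF partials_add[OF partials_propagator[OF smooth_deriv[OF assms], of 1]
      partials_propagator_t[OF smooth_deriv[OF assms], of 1]], of 2]
  by (auto simp: sol_x_def[abs_def] sol_xx_def[abs_def])

text \<open>The second time derivative of \<open>propagator_t\<close> needs no further derivative of the kernel: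
  \<open>propagator_pde\<close> expresses \<open>propagator_tt\<close> by space derivatives, and these are differentiated
  in time by \<open>partials_propagator\<close>.\<close>

lemma partials_sol_t:
  assumes "smooth \<phi>"
  shows "\<exists>h. partials (sol_t \<phi>) (\<lambda>t x. x\<^sup>2 * sol_xx \<phi> t x + 2 * x * sol_x \<phi> t x) h"
proof -
  let ?\<phi>1 = "deriv \<phi>" and ?\<phi>2 = "deriv (deriv \<phi>)"
  note sm = smooth_deriv[OF assms] smooth_deriv[OF smooth_deriv[OF assms]]
  have propagator_tt: "propagator_tt 0 \<phi> = (\<lambda>t x. x\<^sup>2 * propagator 2 ?\<phi>2 t x +
      2 * x * propagator 1 ?\<phi>1 t x)"
    by (intro ext propagator_pde assms)
  have x2: "partials (\<lambda>t x. x\<^sup>2) (\<lambda>t x. 0) (\<lambda>t x. 2 * x)"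
    and x1: "partials (\<lambda>t x. 2 * x) (\<lambda>t x. 0) (\<lambda>t x. 2)"
    by (rule partials_only_x; auto intro!: derivative_eq_intros continuous_intros)+
  obtain h where "partials (propagator_tt 0 \<phi>) (\<lambda>t x. x\<^sup>2 * propagator_t 2 ?\<phi>2 t x +
      2 * x * propagator_t 1 ?\<phi>1 t x) h"
    using partials_add[OF partials_mult[OF x2 partials_propagator[OF sm(2), of 2]]
        partials_mult[OF x1 partials_propagator[OF sm(1), of 1]]]
    unfolding propagator_tt by (auto simp: mult.commute)
  from partials_divide[OF partials_add[OF partials_propagator_t[OF assms, of 0] this], of 2]
  show ?thesis
    by (auto simp: sol_t_def[abs_def] sol_xx_def sol_x_def propagator_tt algebra_simps
        add_divide_distrib)
qed

lemma sol_initial: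
  assumes "smooth \<phi>" shows "sol \<phi> 0 x = \<phi> x" "sol_t \<phi> 0 x = \<phi> x"
  by (simp_all add: sol_def sol_t_def propagator_pde[OF assms])
     (simp_all add: propagator_def propagator_t_def endpoint_terms_def ray_integral_def)

lemma sol_eq_0:
  assumes "\<And>y. y \<notin> {a<..<b} \<Longrightarrow> \<phi> y = 0" and "0 \<le> t" "t \<le> T"
    and "x \<le> a * exp (- T) \<or> x \<ge> b * exp T" and "0 \<le> a" "0 \<le> b"
  shows "sol \<phi> t x = 0"
proof -
  have "\<phi> (x * exp (t * s)) = 0" if s: "s \<in> {-1..1}" for s
  proof -
    have "\<bar>t * s\<bar> \<le> T * 1" unfolding abs_mult using assms(2,3) s by (intro mult_mono) auto
    then have ts: "t * s \<le> T" "- T \<le> t * s" by auto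
    have "x * exp (t * s) \<le> a \<or> x * exp (t * s) \<ge> b"
      using assms(4)
    proof
      assume "x \<le> a * exp (- T)"
      then have "x * exp (t * s) \<le> a * exp (- T) * exp (t * s)" by simp
      also have "\<dots> \<le> a * exp (- T) * exp T" using ts assms(5) by (intro mult_left_mono) auto
      finally show ?thesis by (simp add: mult.assoc flip: exp_add)
    next
      assume "x \<ge> b * exp T"
      then have "x * exp (t * s) \<ge> b * exp T * exp (t * s)" by simp
      moreover have "b * exp T * exp (t * s) \<ge> b * exp T * exp (- T)"
        using ts assms(6) by (intro mult_left_mono) auto
      ultimately show ?thesis by (simp add: mult.assoc flip: exp_add)
    qed
    then show ?thesis using assms(1) by auto
  qed
  from propagator_eq_0[of \<phi>, OF this] show ?thesis by (simp add: sol_def)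
qed

section \<open>Derivatives on the strip\<close>

definition strip_partials ::
    "real \<Rightarrow> (real \<Rightarrow> real \<Rightarrow> real) \<Rightarrow> (real \<Rightarrow> real \<Rightarrow> real) \<Rightarrow> (real \<Rightarrow> real \<Rightarrow> real) \<Rightarrow> bool" where
  "strip_partials T f ft fx \<longleftrightarrow>
     (\<forall>t\<in>{0..T}. \<forall>x\<in>{0<..1}.
        ((\<lambda>s. f s x) has_real_derivative ft t x) (at t within {0..T}) \<and>
        (f t has_real_derivative fx t x) (at x within {0<..1})) \<and>
     continuous_on ({0..T} \<times> {0<..1}) (\<lambda>(t, x). ft t x) \<and>
     continuous_on ({0..T} \<times> {0<..1}) (\<lambda>(t, x). fx t x)"

lemma strip_partialsD:
  assumes "strip_partials T f ft fx" "t \<in> {0..T}" "x \<in> {0<..1}"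
  shows "((\<lambda>s. f s x) has_real_derivative ft t x) (at t within {0..T})"
    "(f t has_real_derivative fx t x) (at x within {0<..1})"
  using assms by (auto simp: strip_partials_def)

text \<open>One-sided derivatives at the boundary of the strip are unique, since no point of an interval
  is isolated.\<close>

lemma at_within_nontrivial:
  fixes a b :: real
  assumes "a < b"
  shows "x \<in> {a..b} \<Longrightarrow> at x within {a..b} \<noteq> bot" "x \<in> {a<..b} \<Longrightarrow> at x within {a<..b} \<noteq> bot"
proof -
  have "\<exists>p\<in>S. \<exists>q\<in>S. p \<noteq> q \<Longrightarrow> S \<noteq> {y}" for S :: "real set" and y by auto
  moreover have "\<exists>p\<in>{a..b}. \<exists>q\<in>{a..b}. p \<noteq> q"
    using assms by (intro bexI[of _ a] bexI[of _ b]) auto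
  moreover have "\<exists>p\<in>{a<..b}. \<exists>q\<in>{a<..b}. p \<noteq> q"
    using assms by (intro bexI[of _ "(a + b) / 2"] bexI[of _ b]) auto
  ultimately show "x \<in> {a..b} \<Longrightarrow> at x within {a..b} \<noteq> bot" "x \<in> {a<..b} \<Longrightarrow> at x within {a<..b} \<noteq> bot"
    unfolding trivial_limit_within using connected_imp_perfect[of _ x]
    by (metis connected_Icc, metis connected_Ioc)
qed

lemma real_derivative_unique_within:
  assumes "at x within S \<noteq> bot"
    "(f has_real_derivative D) (at x within S)" "(f has_real_derivative D') (at x within S)"
  shows "D = D'"
  using vector_derivative_unique_within[OF assms(1)] assms(2,3)
  by (simp add: has_real_derivative_iff_has_vector_derivative)

lemma strip_partials_of_C1:
  assumes "C1_on_strip T f" shows "strip_partials T f (d_t T f) (d_x f)"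
  using assms unfolding C1_on_strip_def strip_partials_def d_t_def d_x_def
  by (simp add: has_real_derivative_iff_has_vector_derivative vector_derivative_works)

text \<open>Differentiability in the sense of \<open>d_t\<close> and \<open>d_x\<close> is thus read off from derivatives computed by
  hand, which agree with them on the strip only; outside it \<open>d_t\<close> and \<open>d_x\<close> carry no information.\<close>

lemma strip_partials_determine:
  assumes "T > 0" "strip_partials T f ft fx"
  shows "C1_on_strip T f"
    and "t \<in> {0..T} \<Longrightarrow> x \<in> {0<..1} \<Longrightarrow> d_t T f t x = ft t x"
    and "t \<in> {0..T} \<Longrightarrow> x \<in> {0<..1} \<Longrightarrow> d_x f t x = fx t x"
proof -
  have v: "((\<lambda>s. f s x) has_vector_derivative ft t x) (at t within {0..T})"
    "(f t has_vector_derivative fx t x) (at x within {0<..1})"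
    if "t \<in> {0..T}" "x \<in> {0<..1}" for t x
    using strip_partialsD[OF assms(2) that]
    by (simp_all add: has_real_derivative_iff_has_vector_derivative)
  show dt: "d_t T f t x = ft t x" if "t \<in> {0..T}" "x \<in> {0<..1}" for t x
    unfolding d_t_def
    by (rule vector_derivative_within[OF at_within_nontrivial(1) v(1)]) (use that assms(1) in auto)
  show dx: "d_x f t x = fx t x" if "t \<in> {0..T}" "x \<in> {0<..1}" for t x
    unfolding d_x_def
    by (rule vector_derivative_within[OF at_within_nontrivial(2) v(2)]) (use that in auto)
  have "continuous_on ({0..T} \<times> {0<..1}) (\<lambda>(t, x). d_t T f t x) =
      continuous_on ({0..T} \<times> {0<..1}) (\<lambda>(t, x). ft t x)"
    "continuous_on ({0..T} \<times> {0<..1}) (\<lambda>(t, x). d_x f t x) =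
      continuous_on ({0..T} \<times> {0<..1}) (\<lambda>(t, x). fx t x)"
    by (auto intro!: continuous_on_cong simp: dt dx)
  then show "C1_on_strip T f"
    using assms(2) unfolding C1_on_strip_def strip_partials_def
    by (auto intro!: differentiableI_vector[OF v(1)] differentiableI_vector[OF v(2)])
qed

lemma strip_partials_cong:
  fixes f g :: "real \<Rightarrow> real \<Rightarrow> real"
  assumes "\<And>t x. t \<in> {0..T} \<Longrightarrow> x \<in> {0<..1} \<Longrightarrow> f t x = g t x" "strip_partials T f ft fx"
  shows "strip_partials T g ft fx"
  unfolding strip_partials_def
proof (intro conjI ballI)
  fix t x :: real assume tx: "t \<in> {0..T}" "x \<in> {0<..1}"
  show "((\<lambda>s. g s x) has_real_derivative ft t x) (at t within {0..T})"
    by (rule has_field_derivative_transform_within[OF strip_partialsD(1)[OF assms(2) tx] zero_less_one])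
       (use tx assms(1) in auto)
  show "(g t has_real_derivative fx t x) (at x within {0<..1})"
    by (rule has_field_derivative_transform_within[OF strip_partialsD(2)[OF assms(2) tx] zero_less_one])
       (use tx assms(1) in auto)
qed (use assms(2) in \<open>auto simp: strip_partials_def\<close>)

lemma strip_partials_diff:
  assumes "strip_partials T f ft fx" "strip_partials T g gt gx"
  shows "strip_partials T (\<lambda>t x. f t x - g t x) (\<lambda>t x. ft t x - gt t x) (\<lambda>t x. fx t x - gx t x)"
  using assms unfolding strip_partials_def
  by (auto intro!: DERIV_diff continuous_intros simp: case_prod_unfold)

lemma strip_partials_continuous:
  assumes "strip_partials T f ft fx" "continuous_on S g" "continuous_on S h"
    "\<And>z. z \<in> S \<Longrightarrow> g z \<in> {0..T}" "\<And>z. z \<in> S \<Longrightarrow> h z \<in> {0<..1}"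
  shows "continuous_on S (\<lambda>z. ft (g z) (h z))" "continuous_on S (\<lambda>z. fx (g z) (h z))"
proof -
  have "continuous_on ({0..T} \<times> {0<..1}) (\<lambda>(t, x). ft t x)"
      "continuous_on ({0..T} \<times> {0<..1}) (\<lambda>(t, x). fx t x)"
    using assms(1) by (auto simp: strip_partials_def)
  moreover have "(\<lambda>z. (g z, h z)) ` S \<subseteq> {0..T} \<times> {0<..1}" using assms(4,5) by blast
  ultimately have "continuous_on S (\<lambda>z. case (g z, h z) of (t, x) \<Rightarrow> ft t x)"
    "continuous_on S (\<lambda>z. case (g z, h z) of (t, x) \<Rightarrow> fx t x)"
    using continuous_on_compose2[OF _ continuous_on_Pair[OF assms(2,3)]] by blast+
  then show "continuous_on S (\<lambda>z. ft (g z) (h z))" "continuous_on S (\<lambda>z. fx (g z) (h z))"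
    by simp_all
qed

text \<open>Schwarz's theorem, up to the boundary of the strip. Differentiating
  \<open>f t y - f t a = \<integral>\<^bsub>a\<^esub>\<^bsup>y\<^esup> fx t\<close> in time under the integral gives \<open>ft t y - ft t a = \<integral>\<^bsub>a\<^esub>\<^bsup>y\<^esup> fxt t\<close>, and
  differentiating this in \<open>y\<close> gives the claim.\<close>

lemma strip_mixed_partials_commute:
  assumes "T > 0"
    and f: "strip_partials T f ft fx" and ft: "strip_partials T ft ftt ftx"
    and fx: "strip_partials T fx fxt fxx" and tx: "t \<in> {0..T}" "x \<in> {0<..1}"
  shows "ftx t x = fxt t x"
proof -
  define a where "a = x / 2"
  have a: "0 < a" "a < x" "x \<le> 1" using tx by (auto simp: a_def)
  have sub: "{a..1} \<subseteq> {0<..1}" using a by auto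
  have ft_int: "ft t y - ft t a = integral {a..y} (fxt t)" if y: "y \<in> {a..1}" for y
  proof -
    have int: "f s y - f s a = integral (cbox a y) (fx s)" if "s \<in> {0..T}" for s
    proof -
      have "(fx s has_integral f s y - f s a) {a..y}"
      proof (rule fundamental_theorem_of_calculus)
        fix z assume z: "z \<in> {a..y}"
        have "(f s has_real_derivative fx s z) (at z within {a..y})"
          by (rule DERIV_subset[OF strip_partialsD(2)[OF f that]]) (use z y a in auto)
        then show "(f s has_vector_derivative fx s z) (at z within {a..y})"
          by (simp add: has_real_derivative_iff_has_vector_derivative)
      qed (use y in auto)
      then show ?thesis by (simp add: integral_unique)
    qed
    have "((\<lambda>s. integral (cbox a y) (fx s)) has_real_derivative integral (cbox a y) (fxt t))
        (at t within {0..T})"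
    proof (rule leibniz_rule_field_derivative)
      show "((\<lambda>s. fx s z) has_real_derivative fxt s z) (at s within {0..T})"
        if "s \<in> {0..T}" "z \<in> cbox a y" for s z
        by (rule strip_partialsD(1)[OF fx]) (use that y a in auto)
      show "fx s integrable_on cbox a y" if "s \<in> {0..T}" for s
        by (rule integrable_continuous, rule strip_partials_continuous(2)[OF f])
           (use that y a in \<open>auto intro!: continuous_intros\<close>)
      show "continuous_on ({0..T} \<times> cbox a y) (\<lambda>(s, z). fxt s z)"
        unfolding case_prod_unfold
        by (rule strip_partials_continuous(1)[OF fx]) (use y a in \<open>auto intro!: continuous_intros\<close>)
    qed (use tx in auto)
    then have "((\<lambda>s. f s y - f s a) has_real_derivative integral (cbox a y) (fxt t))
        (at t within {0..T})"
      by (rule has_field_derivative_transform_within[where d = 1]) (use tx int in auto)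
    moreover have "((\<lambda>s. f s y - f s a) has_real_derivative ft t y - ft t a) (at t within {0..T})"
      by (intro DERIV_diff strip_partialsD(1)[OF f]) (use tx y a in auto)
    ultimately show ?thesis
      using real_derivative_unique_within[OF at_within_nontrivial(1)] assms(1) tx
      by (metis cbox_interval)
  qed
  have "((\<lambda>y. integral {a..y} (fxt t)) has_real_derivative fxt t x) (at x within {a..1})"
    by (rule integral_has_real_derivative, rule strip_partials_continuous(1)[OF fx])
       (use tx a in \<open>auto intro!: continuous_intros\<close>)
  then have "((\<lambda>y. ft t y - ft t a) has_real_derivative fxt t x) (at x within {a..1})"
    by (rule has_field_derivative_transform_within[where d = 1]) (use a ft_int in auto)
  moreover have "((\<lambda>y. ft t y - ft t a) has_real_derivative ftx t x) (at x within {a..1})"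
    using DERIV_diff[OF DERIV_subset[OF strip_partialsD(2)[OF ft tx] sub] DERIV_const] by simp
  ultimately show ?thesis
    using real_derivative_unique_within[OF at_within_nontrivial(1)[of a 1 x]] a by force
qed

section \<open>Domain of dependence and uniqueness\<close>

lemma flat_0_deriv: "(flat 0 has_real_derivative flat 2 s) (at s)"
  using flat_deriv[of 0 s] by (simp add: numeral_2_eq_2)

lemma flat_nonneg: "flat k s \<ge> 0"
  by (simp add: flat_def)

lemma continuous_flat: "continuous_on S f \<Longrightarrow> continuous_on S (\<lambda>z. flat k (f z))"
  by (rule continuous_on_compose2[of UNIV "flat k"])
     (auto intro: continuous_at_imp_continuous_on DERIV_isCont[OF flat_deriv])

lemma DERIV_at_interior:
  fixes t :: real
  assumes "(f has_real_derivative D) (at t within S)" "t \<in> {a<..<b}" "{a<..<b} \<subseteq> S"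
  shows "(f has_real_derivative D) (at t)"
  using DERIV_subset[OF assms(1,3)] assms(2) by (simp add: at_within_open[OF assms(2)])

text \<open>The sharp region \<open>x > a * exp t\<close> is replaced by the smooth weight \<open>flat 0 (x * exp (- t) - a)\<close>,
  which is positive exactly there; the integral then runs over a fixed interval. The weight is
  transported with the characteristic speed \<open>x\<close>, so its derivatives in \<open>t\<close> and \<open>x\<close> combine with the
  flux \<open>x\<^sup>2 * wx * wt\<close> to minus a perfect square.\<close>

lemma local_energy_decreasing:
  fixes w :: "real \<Rightarrow> real \<Rightarrow> real"
  assumes T: "T > 0" and w: "strip_partials T w wt wx" and wt: "strip_partials T wt wtt wtx"
    and wx: "strip_partials T wx wxt wxx"
    and pde: "\<And>t x. t \<in> {0<..<T} \<Longrightarrow> x \<in> {0<..<1} \<Longrightarrow> wtt t x = x\<^sup>2 * wxx t x + 2 * x * wx t x"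
    and bc: "\<And>t. t \<in> {0<..<T} \<Longrightarrow> w t 1 = 0"
    and a: "0 < a" "a < 1" and t0: "t0 \<in> {0..T}"
  shows "integral {a..1} (\<lambda>x. flat 0 (x * exp (- t0) - a) * ((wt t0 x)\<^sup>2 + x\<^sup>2 * (wx t0 x)\<^sup>2))
     \<le> integral {a..1} (\<lambda>x. flat 0 (x - a) * ((wt 0 x)\<^sup>2 + x\<^sup>2 * (wx 0 x)\<^sup>2))"
proof -
  note c = strip_partials_continuous[OF w] strip_partials_continuous[OF wt]
      strip_partials_continuous[OF wx]
  define cut where "cut t x = flat 0 (x * exp (- t) - a)" for t x
  define cut' where "cut' t x = flat 2 (x * exp (- t) - a)" for t x
  define e where "e t x = cut t x * ((wt t x)\<^sup>2 + x\<^sup>2 * (wx t x)\<^sup>2)" for t x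
  define et where "et t x = - cut' t x * (x * exp (- t)) * ((wt t x)\<^sup>2 + x\<^sup>2 * (wx t x)\<^sup>2)
      + cut t x * (2 * wt t x * wtt t x + x\<^sup>2 * (2 * wx t x * wxt t x))" for t x
  have et_cont: "continuous_on ({0..T} \<times> {a..1}) (\<lambda>z. et (fst z) (snd z))"
    unfolding et_def cut_def cut'_def
    by (intro continuous_intros continuous_flat c) (use a in auto)
  have e_cont: "continuous_on {a..1} (e t)" if "t \<in> {0..T}" for t
    unfolding e_def[abs_def] cut_def
    by (intro continuous_intros continuous_flat c) (use a that in auto)
  define E where "E t = integral (cbox a 1) (e t)" for t
  have E_deriv: "(E has_real_derivative integral (cbox a 1) (et t)) (at t within {0..T})"
    if t: "t \<in> {0..T}" for t
    unfolding E_def[abs_def]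
  proof (rule leibniz_rule_field_derivative)
    fix s x assume sx: "s \<in> {0..T}" "x \<in> cbox a 1"
    then have sx': "x \<in> {0<..1}" using a by auto
    show "((\<lambda>s. e s x) has_real_derivative et s x) (at s within {0..T})"
      unfolding e_def cut_def
      by (rule derivative_eq_intros DERIV_chain2[OF flat_0_deriv]
          strip_partialsD(1)[OF wt sx(1) sx'] strip_partialsD(1)[OF wx sx(1) sx'] refl)+
         (simp add: et_def cut_def cut'_def algebra_simps)
  qed (use t e_cont et_cont in \<open>auto intro!: integrable_continuous_real simp: case_prod_unfold\<close>)
  have et_nonpos: "integral (cbox a 1) (et t) \<le> 0" if t: "t \<in> {0<..<T}" for t
  proof -
    have tT: "t \<in> {0..T}" using t by auto
    \<comment> \<open>Twice the weighted energy flux; its derivative dominates the time derivative of the energy density.\<close>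
    define F where "F x = 2 * cut t x * (x\<^sup>2 * wx t x * wt t x)" for x
    define F' where "F' x = 2 * (cut' t x * exp (- t)) * (x\<^sup>2 * wx t x * wt t x)
       + 2 * cut t x * ((2 * x * wx t x + x\<^sup>2 * wxx t x) * wt t x + x\<^sup>2 * wx t x * wtx t x)" for x
    have "(F' has_integral F 1 - F a) {a..1}"
    proof (rule fundamental_theorem_of_calculus)
      fix x assume x: "x \<in> {a..1}"
      then have x': "x \<in> {0<..1}" using a by auto
      have "(F has_real_derivative F' x) (at x within {0<..1})"
        unfolding F_def[abs_def] cut_def
        by (rule derivative_eq_intros DERIV_chain2[OF flat_0_deriv]
            strip_partialsD(2)[OF wt tT x'] strip_partialsD(2)[OF wx tT x'] refl)+
           (simp add: F'_def cut_def cut'_def algebra_simps)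
      then have "(F has_real_derivative F' x) (at x within {a..1})"
        by (rule DERIV_subset) (use a in auto)
      then show "(F has_vector_derivative F' x) (at x within {a..1})"
        by (simp add: has_real_derivative_iff_has_vector_derivative)
    qed (use a in auto)
    moreover have "F a = 0"
    proof -
      have "a * exp (- t) \<le> a * 1" using a t by (intro mult_left_mono) auto
      then show ?thesis by (simp add: F_def cut_def flat_def)
    qed
    moreover have "F 1 = 0"
    proof -
      have "((\<lambda>s. w s 1) has_real_derivative wt t 1) (at t)"
        by (rule DERIV_at_interior[OF strip_partialsD(1)[OF w tT] t]) (use t in auto)
      moreover have "((\<lambda>s. w s 1) has_real_derivative 0) (at t)"
        by (rule has_field_derivative_transform_within_open[OF DERIV_const, of "{0<..<T}"])
           (use t bc in auto)
      ultimately have "wt t 1 = 0" by (rule DERIV_unique)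
      then show ?thesis by (simp add: F_def)
    qed
    ultimately have F'_int: "(F' has_integral 0) {a<..<1}"
      by (simp add: has_integral_Icc_iff_Ioo)
    have et_int: "(et t has_integral integral (cbox a 1) (et t)) {a<..<1}"
    proof -
      have "continuous_on {a..1} (et t)"
        using continuous_on_compose2[OF et_cont continuous_on_Pair[OF continuous_on_const[of "{a..1}" t]
            continuous_on_id]] tT
        by (simp add: image_subset_iff)
      from integrable_integral[OF integrable_continuous_real[OF this]]
      show ?thesis by (simp add: has_integral_Icc_iff_Ioo)
    qed
    have "et t x \<le> F' x" if x: "x \<in> {a<..<1}" for x
    proof -
      have x': "x \<in> {0<..<1}" "x \<in> {0<..1}" using x a by auto
      \<comment> \<open>The two terms of the weight and the mixed one from the flux form the square.\<close>
      have "F' x - et t x = cut' t x * (x * exp (- t)) * (wt t x + x * wx t x)\<^sup>2"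
        unfolding F'_def et_def pde[OF t x'(1)] strip_mixed_partials_commute[OF T w wt wx tT x'(2)]
        by (simp add: algebra_simps power2_eq_square)
      also have "\<dots> \<ge> 0"
        using x' by (intro mult_nonneg_nonneg) (auto simp: cut'_def flat_nonneg)
      finally show ?thesis by simp
    qed
    from has_integral_le[OF et_int F'_int this] show ?thesis .
  qed
  have E_DERIV: "(E has_real_derivative integral (cbox a 1) (et t)) (at t)" if "t \<in> {0<..<T}" for t
    by (rule DERIV_at_interior[OF E_deriv that]) (use that in auto)
  have E_cont: "continuous_on {0..t0} E"
    by (rule continuous_on_subset[OF DERIV_continuous_on[of "{0..T}"]]) (use E_deriv t0 in auto)
  have E_mono: "\<exists>y. (E has_real_derivative y) (at t) \<and> y \<le> 0" if "0 < t" "t < t0" for t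
    using E_DERIV[of t] et_nonpos[of t] that t0 by auto
  have "0 \<le> t0" using t0 by simp
  then have "E t0 \<le> E 0"
    by (rule DERIV_nonpos_imp_decreasing_open) (rule E_mono E_cont; assumption)+
  then show ?thesis by (simp add: E_def e_def[abs_def] cut_def)
qed

text \<open>For a given point \<open>x\<close> the parameter \<open>a\<close> is so small that \<open>x\<close> stays in the region \<open>x > a * exp t\<close>
  up to time \<open>T\<close>. The vanishing weighted energy then gives \<open>wt = 0\<close> along the whole vertical line
  through \<open>x\<close>. At \<open>x = 1\<close>, where no initial value is prescribed, the boundary condition fixes the
  constant.\<close>

lemma zero_solution:
  fixes w :: "real \<Rightarrow> real \<Rightarrow> real"
  assumes T: "T > 0" and w: "strip_partials T w wt wx" and wt: "strip_partials T wt wtt wtx"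
    and wx: "strip_partials T wx wxt wxx"
    and pde: "\<And>t x. t \<in> {0<..<T} \<Longrightarrow> x \<in> {0<..<1} \<Longrightarrow> wtt t x = x\<^sup>2 * wxx t x + 2 * x * wx t x"
    and bc: "\<And>t. t \<in> {0<..<T} \<Longrightarrow> w t 1 = 0"
    and ic: "\<And>x. x \<in> {0<..<1} \<Longrightarrow> w 0 x = 0" "\<And>x. x \<in> {0<..<1} \<Longrightarrow> wt 0 x = 0"
    and tx: "t \<in> {0..T}" "x \<in> {0<..1}"
  shows "w t x = 0"
proof -
  define a where "a = x * exp (- T) / 2"
  have "x * exp (- T) \<le> 1 * 1" using tx T by (intro mult_mono) auto
  then have a: "0 < a" "a < 1" using tx by (auto simp: a_def)
  have wx0: "wx 0 y = 0" if y: "y \<in> {0<..<1}" for y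
  proof -
    have "(w 0 has_real_derivative wx 0 y) (at y)"
      by (rule DERIV_at_interior[OF strip_partialsD(2)[OF w] y]) (use T y in auto)
    moreover have "(w 0 has_real_derivative 0) (at y)"
      by (rule has_field_derivative_transform_within_open[OF DERIV_const, of "{0<..<1}"])
         (use y ic in auto)
    ultimately show ?thesis by (rule DERIV_unique)
  qed
  have wt0: "wt s x = 0" if s: "s \<in> {0..T}" for s
  proof -
    let ?e = "\<lambda>x. flat 0 (x * exp (- s) - a) * ((wt s x)\<^sup>2 + x\<^sup>2 * (wx s x)\<^sup>2)"
    have nonneg: "?e x \<ge> 0" for x by (simp add: flat_nonneg)
    have "integral {a..1} ?e \<le> integral {a..1} (\<lambda>x. flat 0 (x - a) * ((wt 0 x)\<^sup>2 + x\<^sup>2 * (wx 0 x)\<^sup>2))"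
      by (rule local_energy_decreasing[OF T w wt wx pde bc a s])
    also have "\<dots> = integral {a<..<1} (\<lambda>x. 0)"
      unfolding integral_open_interval_real
      by (rule integral_cong) (use a wx0 ic in auto)
    finally have "integral {a..1} ?e \<le> 0" by simp
    moreover have cont: "continuous_on {a..1} ?e"
      by (intro continuous_intros continuous_flat strip_partials_continuous[OF w]) (use a s in auto)
    moreover have "integral {a..1} ?e \<ge> 0"
      by (intro integral_nonneg integrable_continuous_real cont nonneg)
    ultimately have e0: "\<forall>x\<in>{a..1}. ?e x = 0"
      using integral_eq_0_iff[OF cont a(2) nonneg] by linarith
    have "a < x * exp (- s)"
    proof -
      have "x * exp (- T) \<le> x * exp (- s)" using s tx by (intro mult_left_mono) auto
      then show ?thesis using a(1) unfolding a_def by linarith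
    qed
    moreover have "x * exp (- s) \<le> x * 1" using s tx by (intro mult_left_mono) auto
    ultimately have "x \<in> {a..1}"
      using tx(2) unfolding atLeastAtMost_iff greaterThanAtMost_iff by linarith
    with e0 have "?e x = 0" by blast
    with \<open>a < x * exp (- s)\<close> show ?thesis
      by (auto simp: flat_def add_nonneg_eq_0_iff)
  qed
  have const: "w s x = w s' x" if "s \<in> {0..T}" "s' \<in> {0..T}" for s s'
  proof -
    have "\<exists>c. \<forall>s\<in>{0..T}. w s x = c"
      by (rule has_field_derivative_zero_constant)
         (use strip_partialsD(1)[OF w _ tx(2)] wt0 in auto)
    with that show ?thesis by auto
  qed
  show ?thesis
  proof (cases "x = 1")
    case True
    then show ?thesis using const[OF tx(1), of "T / 2"] bc[of "T / 2"] T by auto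
  next
    case False
    then show ?thesis using const[OF tx(1), of 0] ic(1)[of x] T tx by auto
  qed
qed

lemma classical_solution_unique:
  assumes T: "T > 0" and u: "classical_solution T u0 u1 u" and v: "classical_solution T u0 u1 v"
    and tx: "t \<in> {0..T}" "x \<in> {0<..1}"
  shows "v t x = u t x"
proof -
  have s: "strip_partials T u (d_t T u) (d_x u)"
      "strip_partials T (d_t T u) (d_t T (d_t T u)) (d_x (d_t T u))"
      "strip_partials T (d_x u) (d_t T (d_x u)) (d_x (d_x u))"
      if "classical_solution T u0 u1 u" for u
    using that unfolding classical_solution_def C2_on_strip_def
    by (auto intro: strip_partials_of_C1)
  have pde: "d_t T (d_t T u) t x = x\<^sup>2 * d_x (d_x u) t x + 2 * x * d_x u t x"
    if u: "classical_solution T u0 u1 u" and t: "t \<in> {0<..<T}" "x \<in> {0<..<1}" for u t x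
  proof -
    have tx: "t \<in> {0..T}" "x \<in> {0<..1}" using t by auto
    have "((\<lambda>y. y\<^sup>2 * d_x u t y) has_real_derivative x\<^sup>2 * d_x (d_x u) t x + 2 * x * d_x u t x)
        (at x within {0<..1})"
      by (rule derivative_eq_intros strip_partialsD(2)[OF s(3)[OF u] tx] refl)+ simp
    then have "d_x (\<lambda>t x. x\<^sup>2 * d_x u t x) t x = x\<^sup>2 * d_x (d_x u) t x + 2 * x * d_x u t x"
      unfolding d_x_def[of "\<lambda>t x. x\<^sup>2 * d_x u t x"]
      by (intro vector_derivative_within at_within_nontrivial(2))
         (use tx in \<open>auto simp: has_real_derivative_iff_has_vector_derivative\<close>)
    then show ?thesis using u t unfolding classical_solution_def by force
  qed
  have "v t x - u t x = 0"
  proof (rule zero_solution[OF T strip_partials_diff[OF s(1)[OF v] s(1)[OF u]]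
        strip_partials_diff[OF s(2)[OF v] s(2)[OF u]] strip_partials_diff[OF s(3)[OF v] s(3)[OF u]]
            _ _ _ _ tx])
    show "d_t T (d_t T v) t x - d_t T (d_t T u) t x =
        x\<^sup>2 * (d_x (d_x v) t x - d_x (d_x u) t x) + 2 * x * (d_x v t x - d_x u t x)"
      if "t \<in> {0<..<T}" "x \<in> {0<..<1}" for t x
      using pde[OF u that] pde[OF v that] by (simp add: algebra_simps)
  qed (use u v in \<open>auto simp: classical_solution_def\<close>)
  then show ?thesis by simp
qed

section \<open>Failure of observability\<close>

lemma strip_partials_of_partials:
  "partials f ft fx \<Longrightarrow> strip_partials T f ft fx"
  unfolding partials_def strip_partials_def
  by (auto intro: has_field_derivative_at_within continuous_on_subset)

text \<open>All conditions at the two ends of \<open>]0, 1]\<close> hold because the solution vanishes in a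
  neighbourhood of them: for \<open>x < a * exp (- T)\<close> and for \<open>x > b * exp T\<close>, a region that contains 1.\<close>

lemma classical_solution_sol:
  assumes T: "T > 0" and \<phi>: "smooth \<phi>" and supp: "\<forall>y. y \<notin> {a<..<b} \<longrightarrow> \<phi> y = 0"
    and ab: "0 < a" "0 < b" "b * exp T < 1"
  shows "classical_solution T \<phi> \<phi> (sol \<phi>)"
    and "t \<in> {0..T} \<Longrightarrow> d_x (sol \<phi>) t 1 = 0"
    and "x \<in> {0<..1} \<Longrightarrow> d_t T (sol \<phi>) 0 x = \<phi> x"
    and "x \<in> {0<..1} \<Longrightarrow> d_x (sol \<phi>) 0 x = sol_x \<phi> 0 x"
proof -
  obtain h1 h2 where
    ut: "partials (sol_t \<phi>) (\<lambda>t x. x\<^sup>2 * sol_xx \<phi> t x + 2 * x * sol_x \<phi> t x) h1" and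
    ux: "partials (sol_x \<phi>) h2 (sol_xx \<phi>)"
    using partials_sol_t[OF \<phi>] partials_sol_x[OF \<phi>] by blast
  note P = strip_partials_of_partials[of _ _ _ T]
  note u = partials_sol[OF \<phi>]
  note d = strip_partials_determine(2,3)[OF T P[OF u]]
  have st: "strip_partials T (d_t T (sol \<phi>)) (\<lambda>t x. x\<^sup>2 * sol_xx \<phi> t x + 2 * x * sol_x \<phi> t x) h1"
    by (rule strip_partials_cong[OF _ P[OF ut]]) (simp add: d)
  have sx: "strip_partials T (d_x (sol \<phi>)) h2 (sol_xx \<phi>)"
    by (rule strip_partials_cong[OF _ P[OF ux]]) (simp add: d)
  have x0: "sol_x \<phi> t x = 0" if t: "t \<in> {0..T}" and x: "x \<in> {..<a * exp (- T)} \<union> {b * exp T<..}" for t x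
  proof (rule DERIV_unique)
    show "(sol \<phi> t has_real_derivative sol_x \<phi> t x) (at x)" by (rule partialsD(2)[OF u])
    show "(sol \<phi> t has_real_derivative 0) (at x)"
      by (rule has_field_derivative_transform_within_open[OF DERIV_const _ x])
         (use t ab in \<open>auto intro!: sol_eq_0[OF supp[rule_format], symmetric]\<close>)
  qed
  have C2: "C2_on_strip T (sol \<phi>)"
    unfolding C2_on_strip_def
    using strip_partials_determine(1)[OF T P[OF u]] strip_partials_determine(1)[OF T st]
        strip_partials_determine(1)[OF T sx]
    by blast
  have pde: "d_t T (d_t T (sol \<phi>)) t x - d_x (\<lambda>t x. x\<^sup>2 * d_x (sol \<phi>) t x) t x = 0"
    if "t \<in> {0<..<T}" "x \<in> {0<..<1}" for t x
  proof -
    have tx: "t \<in> {0..T}" "x \<in> {0<..1}" using that by auto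
    have "partials (\<lambda>t x. x\<^sup>2) (\<lambda>t x. 0) (\<lambda>t x. 2 * x)"
      by (rule partials_only_x) (auto intro!: derivative_eq_intros continuous_intros)
    from strip_partials_cong[OF _ P[OF partials_mult[OF this ux]], of "\<lambda>t x. x\<^sup>2 * d_x (sol \<phi>) t x"]
    have "d_x (\<lambda>t x. x\<^sup>2 * d_x (sol \<phi>) t x) t x = 2 * x * sol_x \<phi> t x + sol_xx \<phi> t x * x\<^sup>2"
      using tx by (intro strip_partials_determine(3)[OF T]) (auto simp: d)
    then show ?thesis using strip_partials_determine(2)[OF T st tx] by simp
  qed
  have lim: "((\<lambda>x. x\<^sup>2 * d_x (sol \<phi>) t x) \<longlongrightarrow> 0) (at_right 0)" if "t \<in> {0<..<T}" for t
  proof (rule tendsto_eventually)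
    have "eventually (\<lambda>x. x \<in> {0<..<min 1 (a * exp (- T))}) (at_right 0)"
      using ab by (intro eventually_at_right_real) auto
    then show "eventually (\<lambda>x. x\<^sup>2 * d_x (sol \<phi>) t x = 0) (at_right 0)"
      by eventually_elim (use that in \<open>auto simp: d x0\<close>)
  qed
  have one: "sol \<phi> t 1 = 0" if "t \<in> {0..T}" for t
    using that ab by (intro sol_eq_0[OF supp[rule_format]]) auto
  show "classical_solution T \<phi> \<phi> (sol \<phi>)"
    unfolding classical_solution_def
    using C2 pde lim one T by (auto simp: d sol_initial[OF \<phi>])
  show "t \<in> {0..T} \<Longrightarrow> d_x (sol \<phi>) t 1 = 0"
    using ab by (simp add: d x0)
  show "x \<in> {0<..1} \<Longrightarrow> d_t T (sol \<phi>) 0 x = \<phi> x"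
    using T by (simp add: d sol_initial[OF \<phi>])
  show "x \<in> {0<..1} \<Longrightarrow> d_x (sol \<phi>) 0 x = sol_x \<phi> 0 x"
    using T by (simp add: d)
qed

theorem mainTheorem4:
  fixes T :: real
  assumes "T > 0"
  shows "(\<exists>u\<^sub>0 u\<^sub>1. test_function u\<^sub>0 \<and> test_function u\<^sub>1 \<and>
            (\<exists>x. u\<^sub>0 x \<noteq> 0) \<and> (\<exists>x. u\<^sub>1 x \<noteq> 0) \<and>
            (\<exists>u. classical_solution T u\<^sub>0 u\<^sub>1 u \<and>
                 (\<forall>v. classical_solution T u\<^sub>0 u\<^sub>1 v \<longrightarrow>
                      (\<forall>t\<in>{0..T}. \<forall>x\<in>{0<..1}. v t x = u t x)) \<and>
                 (\<forall>t\<in>{0..T}. d_x u t 1 = 0)))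
         \<and> \<not> observable T"
proof -
  \<comment> \<open>Any \<open>0 < a < b\<close> with \<open>b * exp T < 1\<close> would do.\<close>
  define a where "a = exp (- T) / 4"
  define b where "b = exp (- T) / 2"
  define \<phi> where "\<phi> = bump a b"
  define u where "u = sol \<phi>"
  have ab: "0 < a" "a < b" "b < 1" "0 < b"
  proof -
    have "exp (- T) < 1" using assms by simp
    then show "b < 1" unfolding b_def by linarith
  qed (simp_all add: a_def b_def)
  have bT: "b * exp T < 1" by (simp add: b_def exp_minus)
  have \<phi>: "smooth \<phi>" "\<forall>y. y \<notin> {a<..<b} \<longrightarrow> \<phi> y = 0"
    using bump_eq_0_iff[OF ab(2)] by (auto simp: \<phi>_def smooth_bump)
  note S = classical_solution_sol[OF assms \<phi> ab(1,4) bT, folded u_def]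
  have tf: "test_function \<phi>" unfolding \<phi>_def by (rule test_function_bump[OF ab(1-3)])
  define m where "m = (a + b) / 2"
  have m: "\<phi> m \<noteq> 0" "m \<in> {0..1}"
    using ab unfolding \<phi>_def bump_eq_0_iff[OF ab(2)] by (auto simp: m_def)
  have "\<not> observable T"
  proof
    assume "observable T"
    then obtain C where C: "C > 0" "integral {0..T} (\<lambda>t. (d_x u t 1)\<^sup>2) \<ge> C * energy T u 0"
      unfolding observable_def using tf S(1) by blast
    have "integral {0..T} (\<lambda>t. (d_x u t 1)\<^sup>2) = integral {0..T} (\<lambda>t::real. 0::real)"
      by (rule integral_cong) (simp add: S(2))
    with C have "energy T u 0 \<le> 0" by (simp add: mult_le_0_iff)
    moreover have "energy T u 0 > 0"
    proof -
      define g where "g x = (\<phi> x)\<^sup>2 + x\<^sup>2 * (sol_x \<phi> 0 x)\<^sup>2" for x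
      have cont: "continuous_on {0..1} g"
        unfolding g_def[abs_def]
        by (intro continuous_intros smooth_continuous \<phi>(1)
            continuous_on_binary[OF partials_continuousD(3)[OF partials_sol[OF \<phi>(1)]]])
      have "energy T u 0 = 1 / 2 * integral {0<..<1} g"
        unfolding energy_def by (intro arg_cong[where f = "\<lambda>z. 1 / 2 * z"] integral_cong)
          (simp add: S(3,4) g_def)
      also have "integral {0<..<1} g = integral {0..1} g"
        by (rule integral_open_interval_real[symmetric])
      finally have e: "energy T u 0 = 1 / 2 * integral {0..1} g" .
      have "integral {0..1} g \<noteq> 0"
        using integral_eq_0_iff[OF cont] m by (auto simp: g_def add_nonneg_eq_0_iff)
      moreover have "integral {0..1} g \<ge> 0"
        by (intro integral_nonneg integrable_continuous_real cont) (simp add: g_def)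
      ultimately show ?thesis using e by simp
    qed
    ultimately show False by simp
  qed
  moreover have "\<forall>v. classical_solution T \<phi> \<phi> v \<longrightarrow> (\<forall>t\<in>{0..T}. \<forall>x\<in>{0<..1}. v t x = u t x)"
    using classical_solution_unique[OF assms S(1)] by blast
  ultimately show ?thesis using tf m(1) S(1,2) by blast
qed

end
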